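(* Let $G$ be a game structure of imperfect information with initial state $l_0$. For every $\omega$-regular objective $\phi$, Player~1 has a deterministic observation-based (sure-winning) strategy in $G$ for $\phi$ if and only if $\{l_0\}\sqsubseteq [\![\varphi_\phi]\!]^{\mathcal{A}}$, where $\varphi_\phi$ is the characteristic formula of $\phi$.
   Context: $G=\langle L,l_0,\Sigma,\Delta,\mathcal{O},\gamma\rangle$ is a game structure of imperfect information (finite states $L$, total transition relation $\Delta\subseteq L\times\Sigma\times L$, observations $\mathcal{O}$ whose sets $\gamma(o)$ partition $L$); objectives are sets of infinite sequences of observations and letters, and Player~1 strategies are observation-based (equal observation histories give equal choices). $\mathsf{Post}_\sigma(s)=\{\ell'\mid\exists\ell\in s:(\ell,\sigma,\ell')\in\Delta\}$. An antichain is a set $q$ of nonempty subsets of $L$ such that no element is a strict subset of another; $\mathcal{A}$ is the set of antichains, ordered by $q\sqsubseteq q'$ iff every $s\in q$ is included in some $s'\in q'$. For $q\subseteq 2^L$, $\lceil q\rceil$ is the set of nonempty $\subseteq$-maximal elements of $q$; join is $q\sqcup q'=\lceil q\cup q'\rceil$, meet is $q\sqcap q'=\lceil\{s\cap s'\mid s\in q,s'\in q'\}\rceil$, top is $\{L\}$, bottom is $\emptyset$; this is a complete lattice. The predecessor operator on antichains is $\lceil\mathsf{CPre}\rceil(q)=\lceil\{s\neq\emptyset\mid\exists\sigma\in\Sigma\;\forall o\in\mathcal{O}\;\exists s'\in q:\mathsf{Post}_\sigma(s)\cap\gamma(o)\subseteq s'\}\rceil$. $\mu$-calculus formulas are generated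 by $\varphi::=o\mid x\mid\varphi\lor\varphi\mid\varphi\land\varphi\mid\mathsf{pre}(\varphi)\mid\mu x.\varphi\mid\nu x.\varphi$ ($o\in\mathcal{O}$, $x$ a variable). In the antichain lattice with valuation $\mathcal{E}$: $[\![o]\!]=\{\gamma(o)\}$, $[\![x]\!]=\mathcal{E}(x)$, $\lor,\land$ are interpreted as $\sqcup,\sqcap$, $\mathsf{pre}$ as $\lceil\mathsf{CPre}\rceil$, $[\![\mu x.\varphi]\!]_\mathcal{E}$ is the greatest lower bound (meet over the antichain lattice) of $\{q\mid q=[\![\varphi]\!]_{\mathcal{E}[x\mapsto q]}\}$ and $[\![\nu x.\varphi]\!]_\mathcal{E}$ is the least upper bound (join over the antichain lattice) of that set; for closed formulas the valuation is irrelevant and $[\![\varphi]\!]^{\mathcal{A}}$ denotes the value. The characteristic formula $\varphi_\phi$ of an $\omega$-regular objective $\phi$ is a closed $\mu$-calculus formula such that, for every game structure of perfect information, its evaluation in the lattice of subsets of states (with $\mathsf{pre}$ interpreted as the controllable predecessor: states from which some letter forces all successors into the set) is exactly the set of sure-winning states for $\phi$ (such formulas exist by de Alfaro–Henzinger–Majumdar). *)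

theory Defs
  imports "HOL-Algebra.Lattice" "HOL-Library.Disjoint_Sets"
begin

section \<open>Game structures of imperfect information\<close>

record ('l, 'a, 'o) game =
  states :: "'l set"
  init :: "'l"
  alphabet :: "'a set"
  transitions :: "('l \<times> 'a \<times> 'l) set"
  observations :: "'o set"
  obs_class :: "'o \<Rightarrow> 'l set"

text \<open>Injectivity makes the observation of a state unique; without it two observations could
  name the same block of the partition.\<close>

definition obs_partition :: "'o set \<Rightarrow> ('o \<Rightarrow> 'l set) \<Rightarrow> 'l set \<Rightarrow> bool" where
  "obs_partition Obs \<gamma> L \<longleftrightarrow> inj_on \<gamma> Obs \<and> partition_on L (\<gamma> ` Obs)"

definition game_structure :: "('l, 'a, 'o) game \<Rightarrow> bool" where
  "game_structure G \<longleftrightarrow>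
     finite (states G) \<and> init G \<in> states G \<and> finite (alphabet G) \<and>
     transitions G \<subseteq> states G \<times> alphabet G \<times> states G \<and>
     (\<forall>l\<in>states G. \<forall>\<sigma>\<in>alphabet G. \<exists>l'. (l, \<sigma>, l') \<in> transitions G) \<and>
     obs_partition (observations G) (obs_class G) (states G)"

definition perfect_information :: "('l, 'a, 'l) game \<Rightarrow> bool" where
  "perfect_information G \<longleftrightarrow>
     observations G = states G \<and> (\<forall>l\<in>states G. obs_class G l = {l})"

definition Post :: "('l, 'a, 'o) game \<Rightarrow> 'a \<Rightarrow> 'l set \<Rightarrow> 'l set" where
  "Post G \<sigma> s = {l'. \<exists>l\<in>s. (l, \<sigma>, l') \<in> transitions G}"

definition observation_of :: "'o set \<Rightarrow> ('o \<Rightarrow> 'l set) \<Rightarrow> 'l \<Rightarrow> 'o" where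
  "observation_of Obs \<gamma> l = (THE ob. ob \<in> Obs \<and> l \<in> \<gamma> ob)"

section \<open>Plays, strategies, objectives\<close>

text \<open>An infinite alternating sequence \<open>x\<^sub>0 \<sigma>\<^sub>0 x\<^sub>1 \<sigma>\<^sub>1 \<dots>\<close> is the word \<open>i \<mapsto> (x\<^sub>i, \<sigma>\<^sub>i)\<close>;
  a finite one \<open>x\<^sub>0 \<sigma>\<^sub>0 \<dots> \<sigma>\<^bsub>n-1\<^esub> x\<^sub>n\<close> is the pair \<open>([(x\<^sub>0, \<sigma>\<^sub>0), \<dots>, (x\<^bsub>n-1\<^esub>, \<sigma>\<^bsub>n-1\<^esub>)], x\<^sub>n)\<close>.\<close>

type_synonym ('x, 'a) word = "nat \<Rightarrow> 'x \<times> 'a"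
type_synonym ('x, 'a) prefix = "('x \<times> 'a) list \<times> 'x"

definition Plays :: "('l, 'a, 'o) game \<Rightarrow> ('l, 'a) word set" where
  "Plays G = {\<pi>. fst (\<pi> 0) = init G \<and>
     (\<forall>i. (fst (\<pi> i), snd (\<pi> i), fst (\<pi> (Suc i))) \<in> transitions G)}"

definition prefix_of :: "('x, 'a) word \<Rightarrow> nat \<Rightarrow> ('x, 'a) prefix" where
  "prefix_of \<pi> n = (map \<pi> [0..<n], fst (\<pi> n))"

definition Prefs :: "('l, 'a, 'o) game \<Rightarrow> ('l, 'a) prefix set" where
  "Prefs G = {prefix_of \<pi> n | \<pi> n. \<pi> \<in> Plays G}"

definition relabel_word :: "('x \<Rightarrow> 'y) \<Rightarrow> ('x, 'a) word \<Rightarrow> ('y, 'a) word" where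
  "relabel_word f w = (\<lambda>i. (f (fst (w i)), snd (w i)))"

definition relabel_prefix :: "('x \<Rightarrow> 'y) \<Rightarrow> ('x, 'a) prefix \<Rightarrow> ('y, 'a) prefix" where
  "relabel_prefix f \<rho> = (map (\<lambda>(x, \<sigma>). (f x, \<sigma>)) (fst \<rho>), f (snd \<rho>))"

definition obs_word :: "('l, 'a, 'o) game \<Rightarrow> ('l, 'a) word \<Rightarrow> ('o, 'a) word" where
  "obs_word G = relabel_word (observation_of (observations G) (obs_class G))"

definition obs_prefix :: "('l, 'a, 'o) game \<Rightarrow> ('l, 'a) prefix \<Rightarrow> ('o, 'a) prefix" where
  "obs_prefix G = relabel_prefix (observation_of (observations G) (obs_class G))"

definition strategy :: "('l, 'a, 'o) game \<Rightarrow> (('l, 'a) prefix \<Rightarrow> 'a) \<Rightarrow> bool" where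
  "strategy G \<alpha> \<longleftrightarrow> (\<forall>\<rho>\<in>Prefs G. \<alpha> \<rho> \<in> alphabet G)"

definition observation_based :: "('l, 'a, 'o) game \<Rightarrow> (('l, 'a) prefix \<Rightarrow> 'a) \<Rightarrow> bool" where
  "observation_based G \<alpha> \<longleftrightarrow>
     (\<forall>\<rho>\<in>Prefs G. \<forall>\<rho>'\<in>Prefs G. obs_prefix G \<rho> = obs_prefix G \<rho>' \<longrightarrow> \<alpha> \<rho> = \<alpha> \<rho>')"

definition Outcome :: "('l, 'a, 'o) game \<Rightarrow> (('l, 'a) prefix \<Rightarrow> 'a) \<Rightarrow> ('l, 'a) word set" where
  "Outcome G \<alpha> = {\<pi> \<in> Plays G. \<forall>i. snd (\<pi> i) = \<alpha> (prefix_of \<pi> i)}"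

definition sure_winning ::
    "('l, 'a, 'o) game \<Rightarrow> ('o, 'a) word set \<Rightarrow> (('l, 'a) prefix \<Rightarrow> 'a) \<Rightarrow> bool" where
  "sure_winning G \<phi> \<alpha> \<longleftrightarrow> (\<forall>\<pi>\<in>Outcome G \<alpha>. obs_word G \<pi> \<in> \<phi>)"

definition has_sure_winning_strategy :: "('l, 'a, 'o) game \<Rightarrow> ('o, 'a) word set \<Rightarrow> bool" where
  "has_sure_winning_strategy G \<phi> \<longleftrightarrow>
     (\<exists>\<alpha>. strategy G \<alpha> \<and> observation_based G \<alpha> \<and> sure_winning G \<phi> \<alpha>)"

definition sure_winning_states :: "('l, 'a, 'o) game \<Rightarrow> ('o, 'a) word set \<Rightarrow> 'l set" where
  "sure_winning_states G \<phi> = {l \<in> states G. has_sure_winning_strategy (G\<lparr>init := l\<rparr>) \<phi>}"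

text \<open>Omega-regularity over the alphabet \<open>A\<close>: recognisability by a finite nondeterministic
  Buechi automaton, with states taken from \<open>nat\<close> without loss of generality.\<close>

definition buchi_language ::
    "'q set \<Rightarrow> ('q \<times> 'c \<times> 'q) set \<Rightarrow> 'q set \<Rightarrow> (nat \<Rightarrow> 'c) set" where
  "buchi_language I \<delta> F =
     {w. \<exists>r. r 0 \<in> I \<and> (\<forall>i. (r i, w i, r (Suc i)) \<in> \<delta>) \<and> (\<exists>\<^sub>\<infinity>i. r i \<in> F)}"

definition omega_regular :: "'c set \<Rightarrow> (nat \<Rightarrow> 'c) set \<Rightarrow> bool" where
  "omega_regular A \<phi> \<longleftrightarrow>
     (\<exists>(Q :: nat set) I \<delta> F. finite Q \<and> I \<subseteq> Q \<and> F \<subseteq> Q \<and> \<delta> \<subseteq> Q \<times> A \<times> Q \<and>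
        \<phi> = buchi_language I \<delta> F)"

section \<open>Mu-calculus\<close>

datatype (atoms: 'o) mu =
    Atom 'o
  | Var nat
  | Or "'o mu" "'o mu"
  | And "'o mu" "'o mu"
  | Pre "'o mu"
  | Mu nat "'o mu"
  | Nu nat "'o mu"

primrec free_vars :: "'o mu \<Rightarrow> nat set" where
  "free_vars (Atom ob) = {}"
| "free_vars (Var x) = {x}"
| "free_vars (Or f g) = free_vars f \<union> free_vars g"
| "free_vars (And f g) = free_vars f \<union> free_vars g"
| "free_vars (Pre f) = free_vars f"
| "free_vars (Mu x f) = free_vars f - {x}"
| "free_vars (Nu x f) = free_vars f - {x}"

subsection \<open>Lattice of subsets of states\<close>

definition CPre :: "('l, 'a, 'p) game \<Rightarrow> 'l set \<Rightarrow> 'l set" where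
  "CPre G q = {l \<in> states G. \<exists>\<sigma>\<in>alphabet G. Post G \<sigma> {l} \<subseteq> q}"

text \<open>The argument \<open>\<gamma>\<close> gives the meaning of the atoms.  The intersection with \<open>states G\<close> makes
  the case of \<open>Mu\<close> the meet in the lattice of subsets of \<open>states G\<close>.\<close>

primrec subset_sem ::
    "('l, 'a, 'p) game \<Rightarrow> ('o \<Rightarrow> 'l set) \<Rightarrow> 'o mu \<Rightarrow> (nat \<Rightarrow> 'l set) \<Rightarrow> 'l set" where
  "subset_sem G \<gamma> (Atom ob) E = \<gamma> ob"
| "subset_sem G \<gamma> (Var x) E = E x"
| "subset_sem G \<gamma> (Or f g) E = subset_sem G \<gamma> f E \<union> subset_sem G \<gamma> g E"
| "subset_sem G \<gamma> (And f g) E = subset_sem G \<gamma> f E \<inter> subset_sem G \<gamma> g E"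
| "subset_sem G \<gamma> (Pre f) E = CPre G (subset_sem G \<gamma> f E)"
| "subset_sem G \<gamma> (Mu x f) E =
     states G \<inter> \<Inter>{q. q \<subseteq> states G \<and> q = subset_sem G \<gamma> f (E(x := q))}"
| "subset_sem G \<gamma> (Nu x f) E =
     \<Union>{q. q \<subseteq> states G \<and> q = subset_sem G \<gamma> f (E(x := q))}"

definition subset_value :: "('l, 'a, 'p) game \<Rightarrow> ('o \<Rightarrow> 'l set) \<Rightarrow> 'o mu \<Rightarrow> 'l set" where
  "subset_value G \<gamma> f = subset_sem G \<gamma> f (\<lambda>_. {})"

subsection \<open>Lattice of antichains\<close>

definition antichains :: "'l set \<Rightarrow> 'l set set set" where
  "antichains L = {q. q \<subseteq> Pow L - {{}} \<and> (\<forall>s\<in>q. \<forall>s'\<in>q. \<not> s \<subset> s')}"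

definition antichain_le :: "'l set set \<Rightarrow> 'l set set \<Rightarrow> bool" where
  "antichain_le q q' \<longleftrightarrow> (\<forall>s\<in>q. \<exists>s'\<in>q'. s \<subseteq> s')"

definition antichain_order :: "'l set \<Rightarrow> 'l set set gorder" where
  "antichain_order L = \<lparr>carrier = antichains L, eq = (=), le = antichain_le\<rparr>"

definition max_sets :: "'l set set \<Rightarrow> 'l set set" where
  "max_sets q = {s \<in> q. s \<noteq> {} \<and> (\<forall>s'\<in>q. \<not> s \<subset> s')}"

definition antichain_join :: "'l set set \<Rightarrow> 'l set set \<Rightarrow> 'l set set" where
  "antichain_join q q' = max_sets (q \<union> q')"

definition antichain_meet :: "'l set set \<Rightarrow> 'l set set \<Rightarrow> 'l set set" where
  "antichain_meet q q' = max_sets {s \<inter> s' | s s'. s \<in> q \<and> s' \<in> q'}"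

definition antichain_CPre :: "('l, 'a, 'o) game \<Rightarrow> 'l set set \<Rightarrow> 'l set set" where
  "antichain_CPre G q = max_sets {s. s \<subseteq> states G \<and> s \<noteq> {} \<and>
     (\<exists>\<sigma>\<in>alphabet G. \<forall>ob\<in>observations G. \<exists>s'\<in>q. Post G \<sigma> s \<inter> obs_class G ob \<subseteq> s')}"

primrec antichain_sem ::
    "('l, 'a, 'o) game \<Rightarrow> 'o mu \<Rightarrow> (nat \<Rightarrow> 'l set set) \<Rightarrow> 'l set set" where
  "antichain_sem G (Atom ob) E = {obs_class G ob}"
| "antichain_sem G (Var x) E = E x"
| "antichain_sem G (Or f g) E = antichain_join (antichain_sem G f E) (antichain_sem G g E)"
| "antichain_sem G (And f g) E = antichain_meet (antichain_sem G f E) (antichain_sem G g E)"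
| "antichain_sem G (Pre f) E = antichain_CPre G (antichain_sem G f E)"
| "antichain_sem G (Mu x f) E =
     \<Sqinter>\<^bsub>antichain_order (states G)\<^esub>
       {q \<in> antichains (states G). q = antichain_sem G f (E(x := q))}"
| "antichain_sem G (Nu x f) E =
     \<Squnion>\<^bsub>antichain_order (states G)\<^esub>
       {q \<in> antichains (states G). q = antichain_sem G f (E(x := q))}"

definition antichain_value :: "('l, 'a, 'o) game \<Rightarrow> 'o mu \<Rightarrow> 'l set set" where
  "antichain_value G f = antichain_sem G f (\<lambda>_. {})"

section \<open>Characteristic formulas\<close>

text \<open>An objective over the observations \<open>Obs\<close> makes sense in a game of perfect information,
  whose own observations are its states, once the states are labelled by \<open>Obs\<close>: Player 1 sees
  the states, while the objective and the atoms of the formula refer to the labels.  All such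
  games are finite, so quantifying over games with states in \<open>nat\<close> covers every game up to
  isomorphism; a quantifier over state types is not available.\<close>

definition characteristic_formula ::
    "'o set \<Rightarrow> 'a set \<Rightarrow> ('o, 'a) word set \<Rightarrow> 'o mu \<Rightarrow> bool" where
  "characteristic_formula Obs \<Sigma> \<phi> f \<longleftrightarrow>
     free_vars f = {} \<and> atoms f \<subseteq> Obs \<and>
     (\<forall>(H :: (nat, 'a, nat) game) \<gamma>.
        game_structure H \<and> perfect_information H \<and> alphabet H = \<Sigma> \<and>
        obs_partition Obs \<gamma> (states H) \<longrightarrow>
        subset_value H \<gamma> f =
          sure_winning_states H {w. relabel_word (observation_of Obs \<gamma>) w \<in> \<phi>})"

end

theory Submission
  imports Defs
begin

text \<open>In the subset construction the states are the nonempty sets of states of \<open>G\<close> sharing one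
  observation, i.e. the possible knowledge of Player 1.  This game has perfect information, and
  Player 1 wins it iff she wins \<open>G\<close>: one direction follows the knowledge along a play, the other finds, by
  Koenig's lemma, a play of \<open>G\<close> inside every play of the construction.  Sending an
  antichain to the states of the construction lying below one of its elements commutes with all operations of the
  mu-calculus; for the fixpoints this holds because in finite lattices they are reached by
  iteration from bottom and top, which correspond.  Hence the antichain value of a formula
  describes its value in the subset construction.\<close>

section \<open>Iterated fixpoints in finite orders\<close>

text \<open>\<open>below\<close> is not a lattice isomorphism. Its values are closed under passing
  to smaller decoded sets, whereas the fixpoints of the subset construction range over all sets of
  codes. It is not injective either: with at least two observations, the top antichain and the
  antichain of all observation classes have the same image. So fixpoints cannot simply be carried
  across, and the extremal ones are compared stage by stage along their iterations. The predecessor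
  is compatible with \<open>below\<close> because its antichain version may pick a different
  covering set for each observation, while the successors of a knowledge set under a letter are just
  the nonempty parts of its \<open>Post\<close> lying in one class.\<close>

locale finite_pointed_order =
  fixes A :: "'x set" and leq :: "'x \<Rightarrow> 'x \<Rightarrow> bool" and bt :: 'x
  assumes fin: "finite A"
    and refl: "x \<in> A \<Longrightarrow> leq x x"
    and antisym: "x \<in> A \<Longrightarrow> y \<in> A \<Longrightarrow> leq x y \<Longrightarrow> leq y x \<Longrightarrow> x = y"
    and trans: "leq x y \<Longrightarrow> leq y z \<Longrightarrow> leq x z"
    and bt: "bt \<in> A"
    and bt_least: "x \<in> A \<Longrightarrow> leq bt x"
begin

text \<open>The iterates from \<open>bt\<close> ascend inside a finite set, so some value recurs,
  and a recurrence in an ascending chain is a fixpoint. Reversing \<open>leq\<close> gives greatest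
  fixpoints. The claim covers all late stages \<open>m\<close>, so that two iterations can be read
  at a common stage, and all prefixed points \<open>p\<close>, which monotonicity in the valuation
  requires.\<close>

lemma iterates_reach_least_fixpoint:
  assumes closed: "\<And>x. x \<in> A \<Longrightarrow> F x \<in> A"
    and mono: "\<And>x y. x \<in> A \<Longrightarrow> y \<in> A \<Longrightarrow> leq x y \<Longrightarrow> leq (F x) (F y)"
  shows "\<exists>n. \<forall>m\<ge>n. (F ^^ m) bt \<in> A \<and> F ((F ^^ m) bt) = (F ^^ m) bt \<and>
    (\<forall>p\<in>A. leq (F p) p \<longrightarrow> leq ((F ^^ m) bt) p)"
proof -
  let ?x = "\<lambda>n. (F ^^ n) bt"
  have inA: "?x n \<in> A" for n
    by (induction n) (auto simp: bt closed)
  have step: "leq (?x n) (?x (Suc n))" for n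
    by (induction n) (use inA in \<open>auto intro: bt_least closed bt mono\<close>)
  have chain: "leq (?x i) (?x (i + k))" for i k
  proof (induction k)
    case 0
    then show ?case using refl inA by simp
  next
    case (Suc k)
    then show ?case using trans step[of "i + k"] by simp
  qed
  have below: "leq (?x n) p" if p: "p \<in> A" "leq (F p) p" for n p
  proof (induction n)
    case 0
    then show ?case using bt_least p by simp
  next
    case (Suc n)
    then show ?case using trans[OF mono[OF inA p(1)] p(2)] by simp
  qed
  have "\<not> inj ?x"
  proof
    assume "inj ?x"
    then have "infinite (range ?x)" using finite_imageD by blast
    then show False using fin inA finite_subset[of "range ?x" A] by blast
  qed
  then obtain i j where "i < j" "?x i = ?x j"
    unfolding inj_def by (metis linorder_neqE_nat)
  \<comment> \<open>As \<open>i < j\<close>, the stage after \<open>i\<close> lies below stage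
    \<open>j\<close>, which equals stage \<open>i\<close>.\<close>
  then have "leq (?x (Suc i)) (?x i)" using chain[of "Suc i" "j - Suc i"] by simp
  then have eq: "?x (Suc i) = ?x i" using antisym inA step by blast
  have "F (?x m) = ?x m" if "m \<ge> i" for m
    using that by (induction m rule: dec_induct) (use eq in auto)
  then show ?thesis using inA below by blast
qed

end

lemma finite_pointed_order_Pow:
  assumes "finite S"
  shows "finite_pointed_order (Pow S) (\<subseteq>) {}" "finite_pointed_order (Pow S) (\<supseteq>) S"
  using assms by unfold_locales auto

section \<open>Antichains\<close>

lemma antichain_le_refl: "antichain_le q q"
  by (auto simp: antichain_le_def)

lemma antichain_le_trans: "antichain_le p q \<Longrightarrow> antichain_le q r \<Longrightarrow> antichain_le p r"
  unfolding antichain_le_def by (meson order_trans)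

text \<open>Antisymmetry rests on the antichain property: a set of \<open>q\<close> lies below a set
  of \<open>q'\<close>, which lies below some \<open>t\<close> of \<open>q\<close>; as the inclusion
  in \<open>t\<close> cannot be strict, all three coincide.\<close>

lemma antichain_le_subset_of_antisym:
  assumes "q \<in> antichains L" "antichain_le q q'" "antichain_le q' q"
  shows "q \<subseteq> q'"
proof
  fix s assume s: "s \<in> q"
  obtain s' where s': "s' \<in> q'" "s \<subseteq> s'" using assms s by (auto simp: antichain_le_def)
  obtain t where t: "t \<in> q" "s' \<subseteq> t" using assms s' by (auto simp: antichain_le_def)
  have "\<not> s \<subset> t" using assms(1) s t by (auto simp: antichains_def)
  then have "s = s'" using s' t by auto
  then show "s \<in> q'" using s' by simp
qed

lemma antichain_le_antisym:
  "q \<in> antichains L \<Longrightarrow> q' \<in> antichains L \<Longrightarrow> antichain_le q q' \<Longrightarrow> antichain_le q' q \<Longrightarrow> q = q'"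
  by (simp add: antichain_le_subset_of_antisym subset_antisym)

lemma finite_antichains: "finite L \<Longrightarrow> finite (antichains L)"
  by (rule finite_subset[of _ "Pow (Pow L)"]) (auto simp: antichains_def)

lemma antichain_finite: "finite L \<Longrightarrow> q \<in> antichains L \<Longrightarrow> finite q"
  by (rule finite_subset[of _ "Pow L"]) (auto simp: antichains_def)

lemma finite_pointed_order_antichains:
  assumes "finite L" "L \<noteq> {}"
  shows "finite_pointed_order (antichains L) antichain_le {}"
    "finite_pointed_order (antichains L) (\<lambda>x y. antichain_le y x) {L}"
proof -
  have bot: "{} \<in> antichains L" "antichain_le {} q" for q
    by (auto simp: antichains_def antichain_le_def)
  show "finite_pointed_order (antichains L) antichain_le {}"
    by (intro finite_pointed_order.intro finite_antichains assms(1) antichain_le_refl bot)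
      (rule antichain_le_antisym antichain_le_trans, assumption+)+
  \<comment> \<open>\<open>{L}\<close> is an antichain only for nonempty \<open>L\<close>, as
    antichains exclude the empty set.\<close>
  have top: "{L} \<in> antichains L" "q \<in> antichains L \<Longrightarrow> antichain_le q {L}" for q
    using assms(2) by (auto simp: antichains_def antichain_le_def)
  show "finite_pointed_order (antichains L) (\<lambda>x y. antichain_le y x) {L}"
    by (intro finite_pointed_order.intro finite_antichains assms(1) antichain_le_refl top)
      (assumption | rule antichain_le_antisym antichain_le_trans, assumption+)+
qed

text \<open>The lattice meet is a choice among greatest lower bounds. A member of \<open>X\<close>
  below all others is one, and antisymmetry leaves no second, so the meet of all fixpoints is known
  once a least fixpoint is at hand.\<close>

lemma antichain_Inf_eqI:
  assumes "X \<subseteq> antichains L" "x \<in> X" "\<And>y. y \<in> X \<Longrightarrow> antichain_le x y"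
  shows "\<Sqinter>\<^bsub>antichain_order L\<^esub> X = x"
  unfolding Lattice.inf_def
proof (rule some_equality)
  show "greatest (antichain_order L) x (Lower (antichain_order L) X)"
    using assms by (auto simp: greatest_def Lower_def antichain_order_def)
next
  fix y assume "greatest (antichain_order L) y (Lower (antichain_order L) X)"
  then show "y = x" using assms antichain_le_antisym[of y L x]
    by (auto simp: greatest_def Lower_def antichain_order_def)
qed

lemma antichain_Sup_eqI:
  assumes "X \<subseteq> antichains L" "x \<in> X" "\<And>y. y \<in> X \<Longrightarrow> antichain_le y x"
  shows "\<Squnion>\<^bsub>antichain_order L\<^esub> X = x"
  unfolding Lattice.sup_def
proof (rule some_equality)
  show "least (antichain_order L) x (Upper (antichain_order L) X)"
    using assms by (auto simp: least_def Upper_def antichain_order_def)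
next
  fix y assume "least (antichain_order L) y (Upper (antichain_order L) X)"
  then show "y = x" using assms antichain_le_antisym[of y L x]
    by (auto simp: least_def Upper_def antichain_order_def)
qed

text \<open>The iteration from the empty antichain stabilises at a fixpoint below all others, which
  is therefore their meet. The first three facts serve monotonicity in the valuation, the last one
  the comparison with the subset construction.\<close>

lemma antichain_lfp:
  assumes "finite L" "L \<noteq> {}"
    and "\<forall>q\<in>antichains L. F q \<in> antichains L"
    and "\<forall>q\<in>antichains L. \<forall>q'\<in>antichains L. antichain_le q q' \<longrightarrow> antichain_le (F q) (F q')"
  defines "X \<equiv> \<Sqinter>\<^bsub>antichain_order L\<^esub> {q \<in> antichains L. q = F q}"
  shows "X \<in> antichains L" "F X = X" "\<And>p. p \<in> antichains L \<Longrightarrow> antichain_le (F p) p \<Longrightarrow> antichain_le X p"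
    "\<exists>n. \<forall>m\<ge>n. X = (F ^^ m) {}"
proof -
  obtain n where n: "\<forall>m\<ge>n. (F ^^ m) {} \<in> antichains L \<and> F ((F ^^ m) {}) = (F ^^ m) {} \<and>
    (\<forall>p\<in>antichains L. antichain_le (F p) p \<longrightarrow> antichain_le ((F ^^ m) {}) p)"
    using finite_pointed_order.iterates_reach_least_fixpoint
      [OF finite_pointed_order_antichains(1)[OF assms(1,2)], of F] assms(3,4) by blast
  have "X = (F ^^ m) {}" if "m \<ge> n" for m
    unfolding X_def using n that by (intro antichain_Inf_eqI) (auto simp: antichain_le_refl)
  with n show "X \<in> antichains L" "F X = X" "\<And>p. p \<in> antichains L \<Longrightarrow> antichain_le (F p) p \<Longrightarrow> antichain_le X p"
    "\<exists>n. \<forall>m\<ge>n. X = (F ^^ m) {}" by auto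
qed

lemma antichain_gfp:
  assumes "finite L" "L \<noteq> {}"
    and "\<forall>q\<in>antichains L. F q \<in> antichains L"
    and "\<forall>q\<in>antichains L. \<forall>q'\<in>antichains L. antichain_le q q' \<longrightarrow> antichain_le (F q) (F q')"
  defines "X \<equiv> \<Squnion>\<^bsub>antichain_order L\<^esub> {q \<in> antichains L. q = F q}"
  shows "X \<in> antichains L" "F X = X" "\<And>p. p \<in> antichains L \<Longrightarrow> antichain_le p (F p) \<Longrightarrow> antichain_le p X"
    "\<exists>n. \<forall>m\<ge>n. X = (F ^^ m) {L}"
proof -
  obtain n where n: "\<forall>m\<ge>n. (F ^^ m) {L} \<in> antichains L \<and> F ((F ^^ m) {L}) = (F ^^ m) {L} \<and>
    (\<forall>p\<in>antichains L. antichain_le p (F p) \<longrightarrow> antichain_le p ((F ^^ m) {L}))"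
    using finite_pointed_order.iterates_reach_least_fixpoint
      [OF finite_pointed_order_antichains(2)[OF assms(1,2)], of F] assms(3,4) by blast
  have "X = (F ^^ m) {L}" if "m \<ge> n" for m
    unfolding X_def using n that by (intro antichain_Sup_eqI) (auto simp: antichain_le_refl)
  with n show "X \<in> antichains L" "F X = X" "\<And>p. p \<in> antichains L \<Longrightarrow> antichain_le p (F p) \<Longrightarrow> antichain_le p X"
    "\<exists>n. \<forall>m\<ge>n. X = (F ^^ m) {L}" by auto
qed

section \<open>Reduction to maximal sets; closure and monotonicity of the operations\<close>

lemma max_sets_antichain: "q \<subseteq> Pow L \<Longrightarrow> max_sets q \<in> antichains L"
  by (auto simp: max_sets_def antichains_def)

lemma max_sets_cover:
  assumes "finite q" "s \<in> q" "s \<noteq> {}"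
  obtains t where "t \<in> max_sets q" "s \<subseteq> t"
proof -
  obtain t where "t \<in> q" "s \<subseteq> t" "\<forall>u\<in>q. t \<subseteq> u \<longrightarrow> t = u"
    using finite_has_maximal2[OF assms(1,2)] by blast
  with assms(3) that show thesis by (auto simp: max_sets_def)
qed

text \<open>In a finite family every set lies in a maximal one, so it suffices to compare the
  unreduced families; join, meet and predecessor are all handled this way.\<close>

lemma antichain_le_max_sets:
  assumes "finite Y" "\<And>s. s \<in> X \<Longrightarrow> s \<noteq> {} \<Longrightarrow> \<exists>t\<in>Y. s \<subseteq> t"
  shows "antichain_le (max_sets X) (max_sets Y)"
  unfolding antichain_le_def
proof
  fix s assume "s \<in> max_sets X"
  then have "s \<in> X" "s \<noteq> {}" by (auto simp: max_sets_def)
  then obtain t where t: "t \<in> Y" "s \<subseteq> t" using assms(2) by blast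
  then have "t \<noteq> {}" using \<open>s \<noteq> {}\<close> by auto
  then obtain u where "u \<in> max_sets Y" "t \<subseteq> u" using max_sets_cover[OF assms(1) t(1)] by blast
  then show "\<exists>u\<in>max_sets Y. s \<subseteq> u" using t by blast
qed

text \<open>Reduction does not change which nonempty sets are covered. Nonemptiness matters:
  \<open>max_sets\<close> drops the empty set, so a family consisting of it alone covers
  \<open>{}\<close> before reduction and nothing after.\<close>

lemma ex_superset_max_sets:
  assumes "finite X" "s \<noteq> {}"
  shows "(\<exists>t\<in>max_sets X. s \<subseteq> t) \<longleftrightarrow> (\<exists>t\<in>X. s \<subseteq> t)"
proof
  assume "\<exists>t\<in>X. s \<subseteq> t"
  then obtain t where t: "t \<in> X" "s \<subseteq> t" by blast
  then have "t \<noteq> {}" using assms by auto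
  then obtain u where "u \<in> max_sets X" "t \<subseteq> u" using max_sets_cover[OF assms(1) t(1)] by blast
  with t(2) show "\<exists>t\<in>max_sets X. s \<subseteq> t" by (meson order_trans)
qed (auto simp: max_sets_def)

lemma antichain_join_mono:
  assumes "finite q'" "finite r'" "antichain_le q q'" "antichain_le r r'"
  shows "antichain_le (antichain_join q r) (antichain_join q' r')"
  unfolding antichain_join_def
proof (intro antichain_le_max_sets)
  fix s assume "s \<in> q \<union> r"
  then show "\<exists>t\<in>q' \<union> r'. s \<subseteq> t"
    using assms(3,4) unfolding antichain_le_def by (meson UnE UnI1 UnI2)
qed (use assms(1,2) in simp)

lemma antichain_meet_mono:
  assumes "finite q'" "finite r'" "antichain_le q q'" "antichain_le r r'"
  shows "antichain_le (antichain_meet q r) (antichain_meet q' r')"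
  unfolding antichain_meet_def
proof (intro antichain_le_max_sets)
  show "finite {s \<inter> s' |s s'. s \<in> q' \<and> s' \<in> r'}"
    using assms by (intro finite_image_set2) auto
next
  fix s assume "s \<in> {s \<inter> s' |s s'. s \<in> q \<and> s' \<in> r}"
  then obtain a b where ab: "s = a \<inter> b" "a \<in> q" "b \<in> r" by blast
  then obtain a' b' where "a' \<in> q'" "b' \<in> r'" "a \<subseteq> a'" "b \<subseteq> b'"
    using assms(3,4) unfolding antichain_le_def by meson
  then show "\<exists>t\<in>{s \<inter> s' |s s'. s \<in> q' \<and> s' \<in> r'}. s \<subseteq> t"
    using ab by (intro bexI[of _ "a' \<inter> b'"]) auto
qed

lemma antichain_CPre_mono:
  assumes "finite (states G)" "antichain_le q q'"
  shows "antichain_le (antichain_CPre G q) (antichain_CPre G q')"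
proof -
  have *: "\<exists>s'\<in>q'. P \<subseteq> s'" if "\<exists>s'\<in>q. P \<subseteq> s'" for P
    using that assms(2) unfolding antichain_le_def by (meson order_trans)
  show ?thesis
    unfolding antichain_CPre_def
  proof (intro antichain_le_max_sets)
    fix s assume "s \<in> {s. s \<subseteq> states G \<and> s \<noteq> {} \<and>
      (\<exists>\<sigma>\<in>alphabet G. \<forall>ob\<in>observations G. \<exists>s'\<in>q. Post G \<sigma> s \<inter> obs_class G ob \<subseteq> s')}"
    then have s: "s \<subseteq> states G" "s \<noteq> {}"
      "\<exists>\<sigma>\<in>alphabet G. \<forall>ob\<in>observations G. \<exists>s'\<in>q. Post G \<sigma> s \<inter> obs_class G ob \<subseteq> s'" by simp_all
    have "\<exists>\<sigma>\<in>alphabet G. \<forall>ob\<in>observations G. \<exists>s'\<in>q'. Post G \<sigma> s \<inter> obs_class G ob \<subseteq> s'"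
      using s(3) * by meson
    with s(1,2) show "\<exists>t\<in>{s. s \<subseteq> states G \<and> s \<noteq> {} \<and>
      (\<exists>\<sigma>\<in>alphabet G. \<forall>ob\<in>observations G. \<exists>s'\<in>q'. Post G \<sigma> s \<inter> obs_class G ob \<subseteq> s')}. s \<subseteq> t"
      by (intro bexI[of _ s] CollectI conjI subset_refl)
  qed (use assms(1) in simp)
qed

lemma antichain_join_closed:
  "q \<in> antichains L \<Longrightarrow> r \<in> antichains L \<Longrightarrow> antichain_join q r \<in> antichains L"
  unfolding antichain_join_def by (rule max_sets_antichain) (auto simp: antichains_def)

lemma antichain_meet_closed:
  "q \<in> antichains L \<Longrightarrow> r \<in> antichains L \<Longrightarrow> antichain_meet q r \<in> antichains L"
  unfolding antichain_meet_def by (rule max_sets_antichain) (auto simp: antichains_def)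

lemma antichain_CPre_closed: "antichain_CPre G q \<in> antichains (states G)"
  unfolding antichain_CPre_def by (rule max_sets_antichain) auto

text \<open>Closure and monotonicity share one induction because a fixpoint case needs both for its
  body: the iteration must stay among antichains and must be monotone.\<close>

lemma antichain_sem_closed_mono:
  assumes G: "game_structure G" and atoms: "atoms f \<subseteq> observations G"
    and E: "\<forall>x. E x \<in> antichains (states G) \<and> E' x \<in> antichains (states G) \<and>
      antichain_le (E x) (E' x)"
  shows "antichain_sem G f E \<in> antichains (states G) \<and>
    antichain_sem G f E' \<in> antichains (states G) \<and>
    antichain_le (antichain_sem G f E) (antichain_sem G f E')"
proof -
  let ?A = "antichains (states G)"
  have fin: "finite (states G)" and ne: "states G \<noteq> {}"
    and part: "partition_on (states G) (obs_class G ` observations G)"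
    using G by (auto simp: game_structure_def obs_partition_def)
  note finA = antichain_finite[OF fin]
  show ?thesis using atoms E
  proof (induction f arbitrary: E E')
    case (Atom ob)
    then have "obs_class G ob \<subseteq> states G" "obs_class G ob \<noteq> {}"
      using part by (auto simp: partition_on_def)
    then show ?case by (auto simp: antichains_def antichain_le_refl)
  next
    case (Var x)
    then show ?case by auto
  next
    case (Or f g)
    have "atoms f \<subseteq> observations G" "atoms g \<subseteq> observations G" using Or.prems by auto
    from Or.IH(1)[OF this(1) Or.prems(2)] Or.IH(2)[OF this(2) Or.prems(2)]
    show ?case by (simp add: antichain_join_closed antichain_join_mono finA)
  next
    case (And f g)
    have "atoms f \<subseteq> observations G" "atoms g \<subseteq> observations G" using And.prems by auto
    from And.IH(1)[OF this(1) And.prems(2)] And.IH(2)[OF this(2) And.prems(2)]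
    show ?case by (simp add: antichain_meet_closed antichain_meet_mono finA)
  next
    case (Pre f)
    then show ?case by (simp add: antichain_CPre_closed antichain_CPre_mono fin)
  next
    case (Mu x f)
    have at: "atoms f \<subseteq> observations G" using Mu.prems by simp
    let ?F = "\<lambda>E q. antichain_sem G f (E(x := q))"
    have IH: "?F D q \<in> ?A \<and> ?F D' q' \<in> ?A \<and> antichain_le (?F D q) (?F D' q')"
      if "\<forall>x. D x \<in> ?A \<and> D' x \<in> ?A \<and> antichain_le (D x) (D' x)" "q \<in> ?A" "q' \<in> ?A"
        "antichain_le q q'" for D D' q q'
      by (rule Mu.IH[OF at]) (use that in auto)
    have closed: "\<forall>q\<in>?A. ?F D q \<in> ?A"
      and mono: "\<forall>q\<in>?A. \<forall>q'\<in>?A. antichain_le q q' \<longrightarrow> antichain_le (?F D q) (?F D q')"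
      if "\<forall>x. D x \<in> ?A" for D
      using IH[of D D] that antichain_le_refl by blast+
    have E: "\<forall>x. E x \<in> ?A" and E': "\<forall>x. E' x \<in> ?A" using Mu.prems by auto
    note l = antichain_lfp[OF fin ne, of "?F E", OF closed[OF E] mono[OF E]]
    note l' = antichain_lfp[OF fin ne, of "?F E'", OF closed[OF E'] mono[OF E']]
    \<comment> \<open>The fixpoint for the larger valuation is a prefixed point of the body under
      the smaller one, so the least fixpoint of the latter lies below it.\<close>
    let ?X' = "\<Sqinter>\<^bsub>antichain_order (states G)\<^esub> {q \<in> ?A. q = ?F E' q}"
    have "antichain_le (?F E ?X') (?F E' ?X')"
      using IH[OF Mu.prems(2) l'(1) l'(1) antichain_le_refl] by simp
    then show ?case using l l' by simp
  next
    case (Nu x f)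
    have at: "atoms f \<subseteq> observations G" using Nu.prems by simp
    let ?F = "\<lambda>E q. antichain_sem G f (E(x := q))"
    have IH: "?F D q \<in> ?A \<and> ?F D' q' \<in> ?A \<and> antichain_le (?F D q) (?F D' q')"
      if "\<forall>x. D x \<in> ?A \<and> D' x \<in> ?A \<and> antichain_le (D x) (D' x)" "q \<in> ?A" "q' \<in> ?A"
        "antichain_le q q'" for D D' q q'
      by (rule Nu.IH[OF at]) (use that in auto)
    have closed: "\<forall>q\<in>?A. ?F D q \<in> ?A"
      and mono: "\<forall>q\<in>?A. \<forall>q'\<in>?A. antichain_le q q' \<longrightarrow> antichain_le (?F D q) (?F D q')"
      if "\<forall>x. D x \<in> ?A" for D
      using IH[of D D] that antichain_le_refl by blast+
    have E: "\<forall>x. E x \<in> ?A" and E': "\<forall>x. E' x \<in> ?A" using Nu.prems by auto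
    note l = antichain_gfp[OF fin ne, of "?F E", OF closed[OF E] mono[OF E]]
    note l' = antichain_gfp[OF fin ne, of "?F E'", OF closed[OF E'] mono[OF E']]
    \<comment> \<open>Dually, the fixpoint for the smaller valuation is postfixed for the body under
      the larger one.\<close>
    let ?X = "\<Squnion>\<^bsub>antichain_order (states G)\<^esub> {q \<in> ?A. q = ?F E q}"
    have "antichain_le (?F E ?X) (?F E' ?X)"
      using IH[OF Nu.prems(2) l(1) l(1) antichain_le_refl] by simp
    then show ?case using l l' by simp
  qed
qed

section \<open>Subsets of states\<close>

lemma subset_lfp:
  assumes "finite S"
    and "\<forall>q\<in>Pow S. F q \<in> Pow S"
    and "\<forall>q\<in>Pow S. \<forall>q'\<in>Pow S. q \<subseteq> q' \<longrightarrow> F q \<subseteq> F q'"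
  defines "X \<equiv> S \<inter> \<Inter>{q. q \<subseteq> S \<and> q = F q}"
  shows "X \<subseteq> S" "F X = X" "\<And>p. p \<subseteq> S \<Longrightarrow> F p \<subseteq> p \<Longrightarrow> X \<subseteq> p" "\<exists>n. \<forall>m\<ge>n. X = (F ^^ m) {}"
proof -
  obtain n where n: "\<forall>m\<ge>n. (F ^^ m) {} \<in> Pow S \<and> F ((F ^^ m) {}) = (F ^^ m) {} \<and>
    (\<forall>p\<in>Pow S. F p \<subseteq> p \<longrightarrow> (F ^^ m) {} \<subseteq> p)"
    using finite_pointed_order.iterates_reach_least_fixpoint
      [OF finite_pointed_order_Pow(1)[OF assms(1)], of F] assms(2,3) by auto
  have "X = (F ^^ m) {}" if "m \<ge> n" for m
  proof
    have fp: "(F ^^ m) {} \<subseteq> S" "(F ^^ m) {} = F ((F ^^ m) {})" using n that by auto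
    then show "X \<subseteq> (F ^^ m) {}" unfolding X_def by (intro le_infI2 Inter_lower CollectI conjI)
    have "(F ^^ m) {} \<subseteq> q" if "q \<subseteq> S" "q = F q" for q
      using n \<open>m \<ge> n\<close> that by (metis PowI order_refl)
    with fp(1) show "(F ^^ m) {} \<subseteq> X" unfolding X_def by blast
  qed
  moreover from this[of n] n have "X \<subseteq> S" "F X = X" "\<forall>p\<in>Pow S. F p \<subseteq> p \<longrightarrow> X \<subseteq> p" by simp_all
  ultimately show "X \<subseteq> S" "F X = X" "\<And>p. p \<subseteq> S \<Longrightarrow> F p \<subseteq> p \<Longrightarrow> X \<subseteq> p" "\<exists>n. \<forall>m\<ge>n. X = (F ^^ m) {}"
    by auto
qed

lemma subset_gfp:
  assumes "finite S"
    and "\<forall>q\<in>Pow S. F q \<in> Pow S"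
    and "\<forall>q\<in>Pow S. \<forall>q'\<in>Pow S. q \<subseteq> q' \<longrightarrow> F q \<subseteq> F q'"
  defines "X \<equiv> \<Union>{q. q \<subseteq> S \<and> q = F q}"
  shows "X \<subseteq> S" "F X = X" "\<And>p. p \<subseteq> S \<Longrightarrow> p \<subseteq> F p \<Longrightarrow> p \<subseteq> X" "\<exists>n. \<forall>m\<ge>n. X = (F ^^ m) S"
proof -
  obtain n where n: "\<forall>m\<ge>n. (F ^^ m) S \<in> Pow S \<and> F ((F ^^ m) S) = (F ^^ m) S \<and>
    (\<forall>p\<in>Pow S. p \<subseteq> F p \<longrightarrow> p \<subseteq> (F ^^ m) S)"
    using finite_pointed_order.iterates_reach_least_fixpoint
      [OF finite_pointed_order_Pow(2)[OF assms(1)], of F] assms(2,3) by auto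
  have "X = (F ^^ m) S" if "m \<ge> n" for m
  proof
    have "(F ^^ m) S \<subseteq> S" "(F ^^ m) S = F ((F ^^ m) S)" using n that by auto
    then show "(F ^^ m) S \<subseteq> X" unfolding X_def by (intro Union_upper CollectI conjI)
    have "q \<subseteq> (F ^^ m) S" if "q \<subseteq> S" "q = F q" for q
      using n \<open>m \<ge> n\<close> that by (metis PowI order_refl)
    then show "X \<subseteq> (F ^^ m) S" unfolding X_def by blast
  qed
  moreover from this[of n] n have "X \<subseteq> S" "F X = X" "\<forall>p\<in>Pow S. p \<subseteq> F p \<longrightarrow> p \<subseteq> X" by simp_all
  ultimately show "X \<subseteq> S" "F X = X" "\<And>p. p \<subseteq> S \<Longrightarrow> p \<subseteq> F p \<Longrightarrow> p \<subseteq> X" "\<exists>n. \<forall>m\<ge>n. X = (F ^^ m) S"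
    by auto
qed

lemma CPre_mono: "q \<subseteq> q' \<Longrightarrow> CPre H q \<subseteq> CPre H q'"
  unfolding CPre_def by blast

lemma subset_sem_closed_mono:
  assumes fin: "finite (states H)" and atoms: "\<forall>ob\<in>atoms f. \<gamma> ob \<subseteq> states H"
    and E: "\<forall>x. E x \<subseteq> E' x \<and> E' x \<subseteq> states H"
  shows "subset_sem H \<gamma> f E \<subseteq> subset_sem H \<gamma> f E' \<and> subset_sem H \<gamma> f E' \<subseteq> states H"
  using atoms E
proof (induction f arbitrary: E E')
  case (Atom ob)
  then show ?case by auto
next
  case (Var x)
  then show ?case by auto
next
  case (Or f g)
  have "\<forall>ob\<in>atoms f. \<gamma> ob \<subseteq> states H" "\<forall>ob\<in>atoms g. \<gamma> ob \<subseteq> states H" using Or.prems by auto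
  from Or.IH(1)[OF this(1) Or.prems(2)] Or.IH(2)[OF this(2) Or.prems(2)]
  show ?case by auto
next
  case (And f g)
  have "\<forall>ob\<in>atoms f. \<gamma> ob \<subseteq> states H" "\<forall>ob\<in>atoms g. \<gamma> ob \<subseteq> states H" using And.prems by auto
  from And.IH(1)[OF this(1) And.prems(2)] And.IH(2)[OF this(2) And.prems(2)]
  show ?case by auto
next
  case (Pre f)
  then have "subset_sem H \<gamma> f E \<subseteq> subset_sem H \<gamma> f E'" by auto
  then show ?case using CPre_mono[of _ _ H] by (simp add: CPre_def)
next
  case (Mu x f)
  have at: "\<forall>ob\<in>atoms f. \<gamma> ob \<subseteq> states H" using Mu.prems by simp
  let ?F = "\<lambda>E q. subset_sem H \<gamma> f (E(x := q))"
  have IH: "?F D q \<subseteq> ?F D' q' \<and> ?F D' q' \<subseteq> states H"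
    if "\<forall>x. D x \<subseteq> D' x \<and> D' x \<subseteq> states H" "q \<subseteq> q'" "q' \<subseteq> states H" for D D' q q'
    by (rule Mu.IH[OF at]) (use that in auto)
  have closed: "\<forall>q\<in>Pow (states H). ?F D q \<in> Pow (states H)"
    and mono: "\<forall>q\<in>Pow (states H). \<forall>q'\<in>Pow (states H). q \<subseteq> q' \<longrightarrow> ?F D q \<subseteq> ?F D q'"
    if "\<forall>x. D x \<subseteq> states H" for D
    using IH[of D D] that by blast+
  have E: "\<forall>x. E x \<subseteq> states H" and E': "\<forall>x. E' x \<subseteq> states H"
    using Mu.prems(2) by (meson order_trans)+
  note l = subset_lfp[OF fin, of "?F E", OF closed[OF E] mono[OF E]]
  note l' = subset_lfp[OF fin, of "?F E'", OF closed[OF E'] mono[OF E']]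
  show ?case unfolding subset_sem.simps
    using l(3)[OF l'(1)] l'(1,2) IH[OF Mu.prems(2) subset_refl l'(1)] by simp
next
  case (Nu x f)
  have at: "\<forall>ob\<in>atoms f. \<gamma> ob \<subseteq> states H" using Nu.prems by simp
  let ?F = "\<lambda>E q. subset_sem H \<gamma> f (E(x := q))"
  have IH: "?F D q \<subseteq> ?F D' q' \<and> ?F D' q' \<subseteq> states H"
    if "\<forall>x. D x \<subseteq> D' x \<and> D' x \<subseteq> states H" "q \<subseteq> q'" "q' \<subseteq> states H" for D D' q q'
    by (rule Nu.IH[OF at]) (use that in auto)
  have closed: "\<forall>q\<in>Pow (states H). ?F D q \<in> Pow (states H)"
    and mono: "\<forall>q\<in>Pow (states H). \<forall>q'\<in>Pow (states H). q \<subseteq> q' \<longrightarrow> ?F D q \<subseteq> ?F D q'"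
    if "\<forall>x. D x \<subseteq> states H" for D
    using IH[of D D] that by blast+
  have E: "\<forall>x. E x \<subseteq> states H" and E': "\<forall>x. E' x \<subseteq> states H"
    using Nu.prems(2) by (meson order_trans)+
  note l = subset_gfp[OF fin, of "?F E", OF closed[OF E] mono[OF E]]
  note l' = subset_gfp[OF fin, of "?F E'", OF closed[OF E'] mono[OF E']]
  show ?case unfolding subset_sem.simps
    using l'(3)[OF l(1)] l'(1) l(1,2) IH[OF Nu.prems(2) subset_refl l(1)] by simp
qed

section \<open>Transfer of strategies\<close>

text \<open>A prefix ends in a state without a letter, hence letters strictly before
  \<open>n\<close> but observations up to and including \<open>n\<close>.\<close>

lemma obs_prefix_eq_iff:
  "obs_prefix G (prefix_of \<pi> n) = obs_prefix G (prefix_of \<pi>' n) \<longleftrightarrow>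
    (\<forall>i<n. snd (\<pi> i) = snd (\<pi>' i)) \<and>
    (\<forall>i\<le>n. observation_of (observations G) (obs_class G) (fst (\<pi> i)) =
      observation_of (observations G) (obs_class G) (fst (\<pi>' i)))"
  by (auto simp: obs_prefix_def relabel_prefix_def prefix_of_def case_prod_beta le_less)

text \<open>A map on plays that keeps the letters and respects indistinguishability pulls
  strategies back: the choice after a history is the choice after the image of any play
  extending it.\<close>

lemma has_sure_winning_strategy_pullback:
  fixes A :: "('l, 'a, 'o) game" and B :: "('m, 'a, 'p) game"
  assumes alphabet: "alphabet A = alphabet B"
    and T: "\<And>\<pi>. \<pi> \<in> Plays A \<Longrightarrow> T \<pi> \<in> Plays B"
    and letters: "\<And>\<pi> i. \<pi> \<in> Plays A \<Longrightarrow> snd (T \<pi> i) = snd (\<pi> i)"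
    and indist: "\<And>\<pi> \<pi>' n. \<pi> \<in> Plays A \<Longrightarrow> \<pi>' \<in> Plays A \<Longrightarrow>
      obs_prefix A (prefix_of \<pi> n) = obs_prefix A (prefix_of \<pi>' n) \<Longrightarrow>
      obs_prefix B (prefix_of (T \<pi>) n) = obs_prefix B (prefix_of (T \<pi>') n)"
    and objective: "\<And>\<pi>. \<pi> \<in> Plays A \<Longrightarrow> obs_word B (T \<pi>) \<in> \<psi> \<Longrightarrow> obs_word A \<pi> \<in> \<phi>"
    and B: "has_sure_winning_strategy B \<psi>"
  shows "has_sure_winning_strategy A \<phi>"
proof -
  obtain \<beta> where \<beta>: "strategy B \<beta>" "observation_based B \<beta>" "sure_winning B \<psi> \<beta>"
    using B by (auto simp: has_sure_winning_strategy_def)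
  have PrefsB: "prefix_of (T \<pi>) n \<in> Prefs B" if "\<pi> \<in> Plays A" for \<pi> n
    using T[OF that] by (auto simp: Prefs_def)
  \<comment> \<open>The choice after the image depends only on the history observed in
    \<open>A\<close>, hence not on which extending play is mapped.\<close>
  have \<beta>_eq: "\<beta> (prefix_of (T \<pi>) n) = \<beta> (prefix_of (T \<pi>') n)"
    if "\<pi> \<in> Plays A" "\<pi>' \<in> Plays A" "obs_prefix A (prefix_of \<pi> n) = obs_prefix A (prefix_of \<pi>' n)"
    for \<pi> \<pi>' n
    using \<beta>(2) indist[OF that] PrefsB that unfolding observation_based_def by blast
  define ext where "ext \<rho> = (SOME \<pi>. \<pi> \<in> Plays A \<and> prefix_of \<pi> (length (fst \<rho>)) = \<rho>)" for \<rho>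
  define \<alpha> where "\<alpha> \<rho> = \<beta> (prefix_of (T (ext \<rho>)) (length (fst \<rho>)))" for \<rho>
  have \<alpha>: "\<alpha> (prefix_of \<pi> n) = \<beta> (prefix_of (T \<pi>) n)" if \<pi>: "\<pi> \<in> Plays A" for \<pi> n
  proof -
    have len: "length (fst (prefix_of \<pi> n)) = n" by (simp add: prefix_of_def)
    have "ext (prefix_of \<pi> n) \<in> Plays A \<and> prefix_of (ext (prefix_of \<pi> n)) n = prefix_of \<pi> n"
      unfolding ext_def len by (rule someI[of _ \<pi>]) (use \<pi> in simp)
    then show ?thesis unfolding \<alpha>_def len using \<beta>_eq \<pi> by metis
  qed
  have "strategy A \<alpha>"
    using \<alpha> \<beta>(1) PrefsB alphabet by (auto simp: strategy_def Prefs_def[of A])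
  moreover have "observation_based A \<alpha>"
    unfolding observation_based_def
  proof (intro ballI impI)
    fix \<rho> \<rho>' assume "\<rho> \<in> Prefs A" "\<rho>' \<in> Prefs A" and eq: "obs_prefix A \<rho> = obs_prefix A \<rho>'"
    then obtain \<pi> n \<pi>' n' where \<rho>: "\<rho> = prefix_of \<pi> n" "\<pi> \<in> Plays A" "\<rho>' = prefix_of \<pi>' n'" "\<pi>' \<in> Plays A"
      by (auto simp: Prefs_def)
    have "n = n'" using arg_cong[OF eq, of "\<lambda>\<rho>. length (fst \<rho>)"] \<rho>
      by (simp add: obs_prefix_def relabel_prefix_def prefix_of_def)
    then show "\<alpha> \<rho> = \<alpha> \<rho>'" using \<alpha> \<beta>_eq eq \<rho> by metis
  qed
  moreover have "sure_winning A \<phi> \<alpha>"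
    unfolding sure_winning_def
  proof
    fix \<pi> assume "\<pi> \<in> Outcome A \<alpha>"
    then have \<pi>: "\<pi> \<in> Plays A" "\<And>i. snd (\<pi> i) = \<alpha> (prefix_of \<pi> i)" by (auto simp: Outcome_def)
    then have "T \<pi> \<in> Outcome B \<beta>" using T \<alpha> letters by (auto simp: Outcome_def)
    then show "obs_word A \<pi> \<in> \<phi>" using objective \<pi>(1) \<beta>(3) by (auto simp: sure_winning_def)
  qed
  ultimately show ?thesis unfolding has_sure_winning_strategy_def by blast
qed

text \<open>Tracing predecessors back gives finite paths of every length. A node continuable to
  every layer has, by finiteness of the next layer, a successor with the same property; moving only
  among such nodes yields the infinite path.\<close>

lemma koenig:
  fixes X :: "nat \<Rightarrow> 'x set"
  assumes fin: "\<And>i. finite (X i)" and ne: "\<And>i. X i \<noteq> {}"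
    and pred: "\<And>i y. y \<in> X (Suc i) \<Longrightarrow> \<exists>x\<in>X i. R i x y"
  obtains p where "\<And>i. p i \<in> X i" "\<And>i. R i (p i) (p (Suc i))"
proof -
  define path where "path i n p \<longleftrightarrow> (\<forall>j. i \<le> j \<and> j \<le> n \<longrightarrow> p j \<in> X j) \<and>
    (\<forall>j. i \<le> j \<and> j < n \<longrightarrow> R j (p j) (p (Suc j)))" for i n p
  \<comment> \<open>The nodes to keep at layer \<open>i\<close> are those with
    \<open>D i x n\<close> for every \<open>n \<ge> i\<close>: they can be continued to any
    layer.\<close>
  define D where "D i x n \<longleftrightarrow> (\<exists>p. p i = x \<and> path i n p)" for i x n
  have path_mono: "path i' m p" if "path i n p" "i \<le> i'" "m \<le> n" for i i' m n p
    using that by (simp add: path_def)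
  then have D_mono: "D i x m" if "D i x n" "m \<le> n" for i x m n
    using that unfolding D_def by blast
  have backward: "\<exists>p. p n = y \<and> path 0 n p" if "y \<in> X n" for n y
    using that
  proof (induction n arbitrary: y)
    case 0
    then show ?case by (intro exI[of _ "\<lambda>_. y"]) (simp add: path_def)
  next
    case (Suc n)
    then obtain x where x: "x \<in> X n" "R n x y" using pred by blast
    then obtain p where "p n = x" "path 0 n p" using Suc.IH by blast
    then show ?case using x Suc.prems
      by (intro exI[of _ "p(Suc n := y)"]) (auto simp: path_def le_Suc_eq less_Suc_eq)
  qed
  have pigeonhole: "\<exists>y\<in>Y. \<forall>n\<ge>k. D k y n"
    if Y: "finite Y" "\<And>n. n \<ge> k \<Longrightarrow> \<exists>y\<in>Y. D k y n" for k Y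
  proof (rule ccontr)
    assume "\<not> ?thesis"
    then obtain b where b: "\<forall>y\<in>Y. b y \<ge> k \<and> \<not> D k y (b y)" by metis
    \<comment> \<open>If each \<open>y\<close> fails at some \<open>b y\<close>, all fail at the
      largest bound by \<open>D_mono\<close>. Inserting \<open>k\<close> ensures
      \<open>k \<le> m\<close> and keeps the maximum defined when \<open>Y\<close> is empty.\<close>
    define m where "m = Max (insert k (b ` Y))"
    have m: "k \<le> m" "\<forall>y\<in>Y. b y \<le> m" using Y(1) by (auto simp: m_def)
    then show False using Y(2)[of m] b D_mono by blast
  qed
  have "\<exists>y\<in>X 0. D 0 y n" for n
  proof -
    obtain y where "y \<in> X n" using ne by blast
    then obtain p where "path 0 n p" using backward by blast
    then have "D 0 (p 0) n" "p 0 \<in> X 0" by (auto simp: D_def path_def)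
    then show ?thesis by blast
  qed
  then obtain x0 where x0: "x0 \<in> X 0" "\<forall>n\<ge>0. D 0 x0 n"
    using pigeonhole[of "X 0" 0] fin by blast
  have step: "\<exists>y. (y \<in> X (Suc i) \<and> (\<forall>n\<ge>Suc i. D (Suc i) y n)) \<and> R i x y"
    if "x \<in> X i \<and> (\<forall>n\<ge>i. D i x n)" for i x
  proof -
    have "\<exists>y\<in>{y \<in> X (Suc i). R i x y}. D (Suc i) y n" if "n \<ge> Suc i" for n
    proof -
      have "D i x n" using \<open>x \<in> X i \<and> (\<forall>n\<ge>i. D i x n)\<close> that by simp
      then obtain p where p: "p i = x" "path i n p" unfolding D_def by blast
      \<comment> \<open>The path witnessing \<open>x\<close>, without its first node, witnesses the
        successor.\<close>
      have "D (Suc i) (p (Suc i)) n" unfolding D_def using path_mono[OF p(2)] by auto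
      moreover have "p (Suc i) \<in> X (Suc i)" "R i x (p (Suc i))" using p that by (auto simp: path_def)
      ultimately show ?thesis by blast
    qed
    then show ?thesis using pigeonhole[of "{y \<in> X (Suc i). R i x y}" "Suc i"] fin by auto
  qed
  obtain p where "\<forall>i. p i \<in> X i \<and> (\<forall>n\<ge>i. D i (p i) n)" "\<forall>i. R i (p i) (p (Suc i))"
    using dependent_nat_choice[of "\<lambda>i x. x \<in> X i \<and> (\<forall>n\<ge>i. D i x n)" R] x0 step by metis
  then show thesis using that by blast
qed

section \<open>The subset construction\<close>

lemma observation_of_eq:
  assumes "obs_partition Obs \<gamma> L" "ob \<in> Obs" "l \<in> \<gamma> ob"
  shows "observation_of Obs \<gamma> l = ob"
  unfolding observation_of_def
proof (rule the_equality)
  fix ob' assume ob': "ob' \<in> Obs \<and> l \<in> \<gamma> ob'"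
  have "\<gamma> ob' = \<gamma> ob"
    using assms ob' unfolding obs_partition_def partition_on_def disjoint_def by blast
  then show "ob' = ob" using assms ob' by (auto simp: obs_partition_def inj_on_def)
qed (use assms in simp)

lemma obs_partition_ex:
  assumes "obs_partition Obs \<gamma> L" "l \<in> L"
  obtains ob where "ob \<in> Obs" "l \<in> \<gamma> ob"
  using assms that unfolding obs_partition_def partition_on_def by blast

lemma Post_mono: "s \<subseteq> t \<Longrightarrow> Post G \<sigma> s \<subseteq> Post G \<sigma> t"
  unfolding Post_def by blast

text \<open>The knowledge sets are represented by codes from an arbitrary type, with decoding \<open>d\<close>, since
  characteristic formulas only speak about games whose states are natural numbers.\<close>

locale subset_construction =
  fixes G :: "('l, 'a, 'o) game" and N :: "'k set" and d :: "'k \<Rightarrow> 'l set"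
  assumes G: "game_structure G"
    and d: "bij_betw d N {s. s \<noteq> {} \<and> (\<exists>ob\<in>observations G. s \<subseteq> obs_class G ob)}"
begin

definition code :: "'l set \<Rightarrow> 'k" where
  "code s = inv_into N d s"

text \<open>Codes decode to nonempty sets only, so \<open>n \<in> N\<close> discards the empty
  intersections of \<open>Post\<close> with a class. The only nondeterminism left is which
  observation arrives.\<close>

definition H :: "('k, 'a, 'k) game" where
  "H = \<lparr>states = N, init = code {init G}, alphabet = alphabet G,
    transitions = {(m, \<sigma>, n). m \<in> N \<and> n \<in> N \<and> \<sigma> \<in> alphabet G \<and>
      (\<exists>ob\<in>observations G. d n = Post G \<sigma> (d m) \<inter> obs_class G ob)},
    observations = N, obs_class = (\<lambda>n. {n})\<rparr>"

text \<open>A decoded set lies in exactly one class; \<open>label\<close> records which, and so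
  interprets the atoms and the objective in a game whose own observations are codes.\<close>

definition label :: "'o \<Rightarrow> 'k set" where
  "label ob = {n \<in> N. d n \<subseteq> obs_class G ob}"

definition below :: "'l set set \<Rightarrow> 'k set" where
  "below q = {n \<in> N. \<exists>s\<in>q. d n \<subseteq> s}"

lemma H_simps [simp]:
  "states H = N" "init H = code {init G}" "alphabet H = alphabet G"
  "observations H = N" "obs_class H = (\<lambda>n. {n})"
  "(m, \<sigma>, n) \<in> transitions H \<longleftrightarrow> m \<in> N \<and> n \<in> N \<and> \<sigma> \<in> alphabet G \<and>
    (\<exists>ob\<in>observations G. d n = Post G \<sigma> (d m) \<inter> obs_class G ob)"
  by (auto simp: H_def)

section \<open>The construction is a finite game of perfect information, labelled by
  observations\<close>

lemma finite_states: "finite (states G)"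
  and init_state: "init G \<in> states G"
  and transitions_subset: "transitions G \<subseteq> states G \<times> alphabet G \<times> states G"
  and total: "l \<in> states G \<Longrightarrow> \<sigma> \<in> alphabet G \<Longrightarrow> \<exists>l'. (l, \<sigma>, l') \<in> transitions G"
  and partition: "obs_partition (observations G) (obs_class G) (states G)"
  using G by (auto simp: game_structure_def)

lemma class_subset: "ob \<in> observations G \<Longrightarrow> obs_class G ob \<subseteq> states G"
  and class_nonempty: "ob \<in> observations G \<Longrightarrow> obs_class G ob \<noteq> {}"
  using partition by (auto simp: obs_partition_def partition_on_def)

lemma d_nonempty: "n \<in> N \<Longrightarrow> d n \<noteq> {}"
  and d_class: "n \<in> N \<Longrightarrow> \<exists>ob\<in>observations G. d n \<subseteq> obs_class G ob"
  using bij_betw_apply[OF d] by auto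

lemma d_subset: "n \<in> N \<Longrightarrow> d n \<subseteq> states G"
  using d_class class_subset by blast

lemma code:
  assumes "s \<noteq> {}" "ob \<in> observations G" "s \<subseteq> obs_class G ob"
  shows "code s \<in> N" "d (code s) = s"
proof -
  have "s \<in> d ` N" using assms bij_betw_imp_surj_on[OF d] by blast
  then show "code s \<in> N" "d (code s) = s"
    unfolding code_def by (simp_all add: inv_into_into f_inv_into_f)
qed

lemma init_code: "code {init G} \<in> N" "d (code {init G}) = {init G}"
proof -
  obtain ob where "ob \<in> observations G" "init G \<in> obs_class G ob"
    using obs_partition_ex[OF partition init_state] .
  then show "code {init G} \<in> N" "d (code {init G}) = {init G}"
    by (intro code[of _ ob]; simp)+
qed

lemma finite_N: "finite N"
proof -
  have "d ` N \<subseteq> Pow (states G)" using d_subset by blast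
  then show ?thesis
    using bij_betw_imp_inj_on[OF d] finite_states by (meson finite_Pow_iff finite_imageD finite_subset)
qed

lemma Post_states: "Post G \<sigma> s \<subseteq> states G"
  using transitions_subset by (auto simp: Post_def)

lemma Post_nonempty:
  assumes "s \<noteq> {}" "s \<subseteq> states G" "\<sigma> \<in> alphabet G"
  shows "Post G \<sigma> s \<noteq> {}"
proof -
  obtain l where "l \<in> s" "l \<in> states G" using assms by blast
  then show ?thesis using total[of l \<sigma>] assms(3) by (auto simp: Post_def)
qed

text \<open>Totality of \<open>G\<close> makes \<open>Post\<close> nonempty, and the classes cover
  it, so some class cuts out a nonempty part.\<close>

lemma H_successor:
  assumes "n \<in> N" "\<sigma> \<in> alphabet G"
  obtains m where "(n, \<sigma>, m) \<in> transitions H"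
proof -
  obtain l where l: "l \<in> Post G \<sigma> (d n)"
    using Post_nonempty[OF d_nonempty d_subset] assms by blast
  obtain ob where ob: "ob \<in> observations G" "l \<in> obs_class G ob"
    using obs_partition_ex[OF partition] Post_states l by blast
  let ?s = "Post G \<sigma> (d n) \<inter> obs_class G ob"
  have "?s \<noteq> {}" using l ob by blast
  from code[OF this ob(1)] have "(n, \<sigma>, code ?s) \<in> transitions H" using assms ob by auto
  then show thesis by (rule that)
qed

lemma perfect_information_H: "perfect_information H"
  by (simp add: perfect_information_def)

lemma game_structure_H: "game_structure H"
proof -
  have "obs_partition N (\<lambda>n. {n}) N"
    by (auto simp: obs_partition_def partition_on_def disjoint_def)
  moreover have "transitions H \<subseteq> N \<times> alphabet G \<times> N" by auto
  moreover have "finite (alphabet G)" using G by (simp add: game_structure_def)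
  moreover have "\<exists>m. (n, \<sigma>, m) \<in> transitions H" if "n \<in> N" "\<sigma> \<in> alphabet G" for n \<sigma>
    using H_successor[OF that] by blast
  ultimately show ?thesis
    unfolding game_structure_def using finite_N init_code by simp
qed

text \<open>A decoded set is nonempty and each of its states has one observation, which makes the
  label unique; injectivity follows because no label set is empty.\<close>

lemma label_partition: "obs_partition (observations G) label N"
proof -
  have unique: "ob = ob'"
    if "n \<in> label ob" "n \<in> label ob'" "ob \<in> observations G" "ob' \<in> observations G" for n ob ob'
  proof -
    have "n \<in> N" using that(1) by (simp add: label_def)
    then obtain l where "l \<in> d n" using d_nonempty by blast
    then show ?thesis
      using that observation_of_eq[OF partition, of ob l] observation_of_eq[OF partition, of ob' l]
      by (auto simp: label_def)
  qed
  have nonempty: "label ob \<noteq> {}" if "ob \<in> observations G" for ob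
    using code[OF class_nonempty[OF that] that] that by (auto simp: label_def)
  have cover: "\<exists>ob\<in>observations G. n \<in> label ob" if "n \<in> N" for n
    using d_class[OF that] that by (auto simp: label_def)
  have "inj_on label (observations G)"
    using unique nonempty by (metis all_not_in_conv inj_onI)
  moreover have "\<Union> (label ` observations G) = N" using cover by (auto simp: label_def)
  moreover have "disjoint (label ` observations G)"
    unfolding disjoint_def using unique by blast
  ultimately show ?thesis
    using nonempty unfolding obs_partition_def partition_on_def by auto
qed

subsection \<open>Agreement of the two semantics\<close>

lemma below_empty: "below {} = {}"
  by (simp add: below_def)

lemma below_top: "below {states G} = N"
  using d_subset by (auto simp: below_def)

lemma below_max_sets: "finite X \<Longrightarrow> below (max_sets X) = {n \<in> N. \<exists>s\<in>X. d n \<subseteq> s}"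
  unfolding below_def
  by (intro Collect_cong conj_cong refl ex_superset_max_sets) (simp_all add: d_nonempty)

lemma below_join: "finite q \<Longrightarrow> finite r \<Longrightarrow> below (antichain_join q r) = below q \<union> below r"
  unfolding antichain_join_def by (subst below_max_sets) (auto simp: below_def)

text \<open>Being included in an intersection means being included in both sets. Empty
  intersections, lost in the reduction, cover no decoded set.\<close>

lemma below_meet:
  assumes "finite q" "finite r"
  shows "below (antichain_meet q r) = below q \<inter> below r"
proof -
  have "finite {s \<inter> s' |s s'. s \<in> q \<and> s' \<in> r}" using assms by (intro finite_image_set2) auto
  then have "below (antichain_meet q r) = {n \<in> N. \<exists>u\<in>{s \<inter> s' |s s'. s \<in> q \<and> s' \<in> r}. d n \<subseteq> u}"
    unfolding antichain_meet_def by (rule below_max_sets)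
  also have "\<dots> = {n \<in> N. (\<exists>s\<in>q. d n \<subseteq> s) \<and> (\<exists>s\<in>r. d n \<subseteq> s)}"
  proof (intro Collect_cong conj_cong refl iffI)
    fix n assume "(\<exists>s\<in>q. d n \<subseteq> s) \<and> (\<exists>s\<in>r. d n \<subseteq> s)"
    then obtain s s' where "s \<in> q" "s' \<in> r" "d n \<subseteq> s \<inter> s'" by (auto simp only: Int_subset_iff)
    then show "\<exists>u\<in>{s \<inter> s' |s s'. s \<in> q \<and> s' \<in> r}. d n \<subseteq> u" by blast
  qed auto
  finally show ?thesis by (simp add: below_def Collect_conj_eq inf_assoc inf_left_commute)
qed

text \<open>The family defining the predecessor is closed under nonempty subsets, so a decoded set
  covered by it belongs to it. Covering each observation part of \<open>Post\<close> by its own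
  member of \<open>q\<close> then means sending all successors in \<open>H\<close> into
  \<open>below q\<close>.\<close>

lemma below_CPre: "below (antichain_CPre G q) = CPre H (below q)"
proof -
  let ?P = "\<lambda>\<sigma> s. \<forall>ob\<in>observations G. \<exists>s'\<in>q. Post G \<sigma> s \<inter> obs_class G ob \<subseteq> s'"
  let ?X = "{s. s \<subseteq> states G \<and> s \<noteq> {} \<and> (\<exists>\<sigma>\<in>alphabet G. ?P \<sigma> s)}"
  have "finite ?X" using finite_states by simp
  then have 1: "below (antichain_CPre G q) = {n \<in> N. \<exists>s\<in>?X. d n \<subseteq> s}"
    unfolding antichain_CPre_def by (rule below_max_sets)
  have 2: "(\<exists>s\<in>?X. d n \<subseteq> s) \<longleftrightarrow> (\<exists>\<sigma>\<in>alphabet G. ?P \<sigma> (d n))" if n: "n \<in> N" for n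
  proof
    assume "\<exists>s\<in>?X. d n \<subseteq> s"
    then obtain s \<sigma> where s: "d n \<subseteq> s" "\<sigma> \<in> alphabet G" "?P \<sigma> s" by blast
    have "Post G \<sigma> (d n) \<inter> obs_class G ob \<subseteq> Post G \<sigma> s \<inter> obs_class G ob" for ob
      using Post_mono[OF s(1), of G \<sigma>] by blast
    with s(3) have "?P \<sigma> (d n)" by (meson order_trans)
    with s(2) show "\<exists>\<sigma>\<in>alphabet G. ?P \<sigma> (d n)" by blast
  next
    assume "\<exists>\<sigma>\<in>alphabet G. ?P \<sigma> (d n)"
    then have "d n \<in> ?X" using n d_subset d_nonempty by simp
    then show "\<exists>s\<in>?X. d n \<subseteq> s" by blast
  qed
  have 3: "?P \<sigma> (d n) \<longleftrightarrow> Post H \<sigma> {n} \<subseteq> below q" if n: "n \<in> N" "\<sigma> \<in> alphabet G" for n \<sigma>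
  proof
    assume P: "?P \<sigma> (d n)"
    show "Post H \<sigma> {n} \<subseteq> below q"
    proof
      fix m assume "m \<in> Post H \<sigma> {n}"
      then obtain ob where "m \<in> N" "ob \<in> observations G" "d m = Post G \<sigma> (d n) \<inter> obs_class G ob"
        by (auto simp: Post_def)
      with P show "m \<in> below q" by (auto simp: below_def)
    qed
  next
    assume sub: "Post H \<sigma> {n} \<subseteq> below q"
    show "?P \<sigma> (d n)"
    proof
      fix ob assume ob: "ob \<in> observations G"
      let ?s = "Post G \<sigma> (d n) \<inter> obs_class G ob"
      show "\<exists>s'\<in>q. ?s \<subseteq> s'"
      proof (cases "?s = {}")
        case True
        \<comment> \<open>An empty part is no state of \<open>H\<close>, so the assumption is silent
          about it. Covering it still takes some member of \<open>q\<close>, which any existing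
          successor supplies.\<close>
        obtain m where "(n, \<sigma>, m) \<in> transitions H" using H_successor[OF n] .
        then have "m \<in> below q" using sub by (auto simp: Post_def)
        then obtain s' where "s' \<in> q" by (auto simp: below_def)
        with True show ?thesis by auto
      next
        case False
        note c = code[OF False ob Int_lower2]
        then have "code ?s \<in> Post H \<sigma> {n}" using n ob by (auto simp: Post_def)
        then have "code ?s \<in> below q" using sub by blast
        then show ?thesis using c(2) by (simp add: below_def)
      qed
    qed
  qed
  show ?thesis
    unfolding 1 CPre_def H_simps
    by (intro Collect_cong conj_cong refl) (simp only: 2 3 cong: bex_cong)
qed

lemma below_fun_upd: "(\<lambda>y. below ((E(x := q)) y)) = (\<lambda>y. below (E y))(x := below q)"
  by (rule ext) simp

lemma body_maps_closed_mono:
  fixes x :: nat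
  assumes "atoms f \<subseteq> observations G" and E: "\<forall>y. E y \<in> antichains (states G)"
  defines "F \<equiv> \<lambda>q. antichain_sem G f (E(x := q))"
    and "F' \<equiv> \<lambda>q. subset_sem H label f ((\<lambda>y. below (E y))(x := q))"
  shows "\<forall>q\<in>antichains (states G). F q \<in> antichains (states G)"
    "\<forall>q\<in>antichains (states G). \<forall>q'\<in>antichains (states G). antichain_le q q' \<longrightarrow> antichain_le (F q) (F q')"
    "\<forall>q\<in>Pow N. F' q \<in> Pow N"
    "\<forall>q\<in>Pow N. \<forall>q'\<in>Pow N. q \<subseteq> q' \<longrightarrow> F' q \<subseteq> F' q'"
proof -
  have *: "F q \<in> antichains (states G) \<and> F q' \<in> antichains (states G) \<and> antichain_le (F q) (F q')"
    if "q \<in> antichains (states G)" "q' \<in> antichains (states G)" "antichain_le q q'" for q q'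
    unfolding F_def using that E antichain_le_refl
    by (intro antichain_sem_closed_mono G assms(1)) auto
  then show "\<forall>q\<in>antichains (states G). F q \<in> antichains (states G)"
    "\<forall>q\<in>antichains (states G). \<forall>q'\<in>antichains (states G). antichain_le q q' \<longrightarrow> antichain_le (F q) (F q')"
    using antichain_le_refl by blast+
  have "F' q \<subseteq> F' q' \<and> F' q' \<subseteq> N" if "q \<subseteq> q'" "q' \<subseteq> N" for q q'
    unfolding F'_def
    by (rule subset_sem_closed_mono[of H, simplified]) (use that finite_N in \<open>auto simp: label_def below_def\<close>)
  then show "\<forall>q\<in>Pow N. F' q \<in> Pow N" "\<forall>q\<in>Pow N. \<forall>q'\<in>Pow N. q \<subseteq> q' \<longrightarrow> F' q \<subseteq> F' q'"
    by blast+
qed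

text \<open>Commutation of \<open>below\<close> with the body is known only on antichains, so
  membership in \<open>A\<close> is carried along the induction.\<close>

lemma below_funpow:
  assumes "b \<in> A" "below b = b'" "\<forall>q\<in>A. F q \<in> A" "\<forall>q\<in>A. below (F q) = F' (below q)"
  shows "below ((F ^^ m) b) = (F' ^^ m) b'"
proof -
  have "(F ^^ m) b \<in> A \<and> below ((F ^^ m) b) = (F' ^^ m) b'"
    by (induction m) (use assms in auto)
  then show ?thesis ..
qed

lemma below_antichain_sem:
  assumes "atoms f \<subseteq> observations G" "\<forall>x. E x \<in> antichains (states G)"
  shows "below (antichain_sem G f E) = subset_sem H label f (\<lambda>x. below (E x))"
  using assms
proof (induction f arbitrary: E)
  case (Atom ob)
  then show ?case by (auto simp: below_def label_def)
next
  case (Var x)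
  then show ?case by simp
next
  case (Or f g)
  have at: "atoms f \<subseteq> observations G" "atoms g \<subseteq> observations G" using Or.prems by auto
  have "finite (antichain_sem G h E)" if "atoms h \<subseteq> observations G" for h
    using antichain_sem_closed_mono[OF G that, of E E] Or.prems(2) antichain_le_refl
      antichain_finite[OF finite_states] by blast
  then show ?case using Or at by (simp add: below_join)
next
  case (And f g)
  have at: "atoms f \<subseteq> observations G" "atoms g \<subseteq> observations G" using And.prems by auto
  have "finite (antichain_sem G h E)" if "atoms h \<subseteq> observations G" for h
    using antichain_sem_closed_mono[OF G that, of E E] And.prems(2) antichain_le_refl
      antichain_finite[OF finite_states] by blast
  then show ?case using And at by (simp add: below_meet)
next
  case (Pre f)
  then show ?case by (simp add: below_CPre)
next
  case (Mu x f)
  let ?F = "\<lambda>q. antichain_sem G f (E(x := q))"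
  let ?F' = "\<lambda>q. subset_sem H label f ((\<lambda>x. below (E x))(x := q))"
  have at: "atoms f \<subseteq> observations G" using Mu.prems by simp
  note F = body_maps_closed_mono[OF at Mu.prems(2), of x]
  have ne: "states G \<noteq> {}" using init_state by blast
  obtain n where n: "\<forall>m\<ge>n. antichain_sem G (Mu x f) E = (?F ^^ m) {}"
    using antichain_lfp(4)[OF finite_states ne F(1,2)] unfolding antichain_sem.simps by blast
  obtain n' where n': "\<forall>m\<ge>n'. subset_sem H label (Mu x f) (\<lambda>x. below (E x)) = (?F' ^^ m) {}"
    using subset_lfp(4)[OF finite_N F(3,4)] unfolding subset_sem.simps H_simps by blast
  have step: "\<forall>q\<in>antichains (states G). below (?F q) = ?F' (below q)"
  proof
    fix q assume "q \<in> antichains (states G)"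
    with Mu.prems(2) have "\<forall>y. (E(x := q)) y \<in> antichains (states G)" by simp
    from Mu.IH[OF at this] show "below (?F q) = ?F' (below q)" unfolding below_fun_upd .
  qed
  have "{} \<in> antichains (states G)" using ne by (auto simp: antichains_def)
  \<comment> \<open>The two iterations may become stationary at different stages; at
    \<open>max n n'\<close> both are.\<close>
  then have "below ((?F ^^ max n n') {}) = (?F' ^^ max n n') {}"
    by (rule below_funpow[OF _ below_empty F(1) step])
  then show ?case using n[rule_format, of "max n n'"] n'[rule_format, of "max n n'"]
    by (simp only: max.cobounded1 max.cobounded2)
next
  case (Nu x f)
  let ?F = "\<lambda>q. antichain_sem G f (E(x := q))"
  let ?F' = "\<lambda>q. subset_sem H label f ((\<lambda>x. below (E x))(x := q))"
  have at: "atoms f \<subseteq> observations G" using Nu.prems by simp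
  note F = body_maps_closed_mono[OF at Nu.prems(2), of x]
  have ne: "states G \<noteq> {}" using init_state by blast
  obtain n where n: "\<forall>m\<ge>n. antichain_sem G (Nu x f) E = (?F ^^ m) {states G}"
    using antichain_gfp(4)[OF finite_states ne F(1,2)] unfolding antichain_sem.simps by blast
  obtain n' where n': "\<forall>m\<ge>n'. subset_sem H label (Nu x f) (\<lambda>x. below (E x)) = (?F' ^^ m) N"
    using subset_gfp(4)[OF finite_N F(3,4)] unfolding subset_sem.simps H_simps by blast
  have step: "\<forall>q\<in>antichains (states G). below (?F q) = ?F' (below q)"
  proof
    fix q assume "q \<in> antichains (states G)"
    with Nu.prems(2) have "\<forall>y. (E(x := q)) y \<in> antichains (states G)" by simp
    from Nu.IH[OF at this] show "below (?F q) = ?F' (below q)" unfolding below_fun_upd .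
  qed
  have "{states G} \<in> antichains (states G)" using ne by (auto simp: antichains_def)
  then have "below ((?F ^^ max n n') {states G}) = (?F' ^^ max n n') N"
    by (rule below_funpow[OF _ below_top F(1) step])
  then show ?case using n[rule_format, of "max n n'"] n'[rule_format, of "max n n'"]
    by (simp only: max.cobounded1 max.cobounded2)
qed

subsection \<open>Agreement of the two games\<close>

abbreviation obs :: "'l \<Rightarrow> 'o" where
  "obs \<equiv> observation_of (observations G) (obs_class G)"

lemma obs_class_obs:
  assumes "l \<in> states G"
  shows "obs l \<in> observations G" "l \<in> obs_class G (obs l)"
proof -
  obtain ob where "ob \<in> observations G" "l \<in> obs_class G ob"
    using obs_partition_ex[OF partition assms] .
  then show "obs l \<in> observations G" "l \<in> obs_class G (obs l)"
    using observation_of_eq[OF partition] by simp_all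
qed

lemma label_obs:
  assumes "n \<in> N" "l \<in> d n"
  shows "observation_of (observations G) label n = obs l"
proof -
  obtain ob where ob: "ob \<in> observations G" "d n \<subseteq> obs_class G ob" using d_class[OF assms(1)] by blast
  then have "obs l = ob" "n \<in> label ob"
    using observation_of_eq[OF partition] assms by (auto simp: label_def)
  then show ?thesis using observation_of_eq[OF label_partition ob(1)] by simp
qed

lemma observation_of_H: "n \<in> N \<Longrightarrow> observation_of (observations H) (obs_class H) n = n"
  by (auto simp: observation_of_def)

lemma Plays_states: "\<pi> \<in> Plays G \<Longrightarrow> fst (\<pi> i) \<in> states G"
  using transitions_subset by (auto simp: Plays_def)

lemma Plays_H_states: "\<kappa> \<in> Plays H \<Longrightarrow> fst (\<kappa> i) \<in> N"
  by (auto simp: Plays_def)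

text \<open>All states in a decoded set share one observation, so a tracking play has the
  observation word of the tracked one, whichever states it visits. Both directions of the strategy
  transfer use this.\<close>

definition tracks :: "('l, 'a) word \<Rightarrow> ('k, 'a) word \<Rightarrow> bool" where
  "tracks \<pi> \<kappa> \<longleftrightarrow> (\<forall>i. fst (\<pi> i) \<in> d (fst (\<kappa> i)) \<and> snd (\<pi> i) = snd (\<kappa> i))"

lemma tracks_obs_word:
  assumes "\<kappa> \<in> Plays H" "tracks \<pi> \<kappa>"
  shows "relabel_word (observation_of (observations G) label) (obs_word H \<kappa>) = obs_word G \<pi>"
proof
  fix i
  have "fst (\<kappa> i) \<in> N" using Plays_H_states[OF assms(1)] .
  then show "relabel_word (observation_of (observations G) label) (obs_word H \<kappa>) i = obs_word G \<pi> i"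
    using label_obs[of "fst (\<kappa> i)" "fst (\<pi> i)"] observation_of_H[of "fst (\<kappa> i)"] assms(2)
    by (auto simp: relabel_word_def obs_word_def tracks_def)
qed

primrec knowledge :: "('l, 'a) word \<Rightarrow> nat \<Rightarrow> 'l set" where
  "knowledge \<pi> 0 = {fst (\<pi> 0)}"
| "knowledge \<pi> (Suc i) =
    Post G (snd (\<pi> i)) (knowledge \<pi> i) \<inter> obs_class G (obs (fst (\<pi> (Suc i))))"

definition knowledge_word :: "('l, 'a) word \<Rightarrow> ('k, 'a) word" where
  "knowledge_word \<pi> i = (code (knowledge \<pi> i), snd (\<pi> i))"

lemma knowledge:
  assumes "\<pi> \<in> Plays G"
  shows "fst (\<pi> i) \<in> knowledge \<pi> i" "knowledge \<pi> i \<subseteq> obs_class G (obs (fst (\<pi> i)))"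
proof -
  show "fst (\<pi> i) \<in> knowledge \<pi> i"
  proof (induction i)
    case (Suc i)
    have "(fst (\<pi> i), snd (\<pi> i), fst (\<pi> (Suc i))) \<in> transitions G" using assms by (simp add: Plays_def)
    with Suc show ?case using obs_class_obs(2)[OF Plays_states[OF assms]] by (auto simp: Post_def)
  qed simp
  show "knowledge \<pi> i \<subseteq> obs_class G (obs (fst (\<pi> i)))"
    using obs_class_obs(2)[OF Plays_states[OF assms]] by (cases i) auto
qed

lemma code_knowledge:
  assumes "\<pi> \<in> Plays G"
  shows "code (knowledge \<pi> i) \<in> N" "d (code (knowledge \<pi> i)) = knowledge \<pi> i"
proof -
  have "knowledge \<pi> i \<noteq> {}" using knowledge(1)[OF assms] by blast
  from code[OF this obs_class_obs(1)[OF Plays_states[OF assms]] knowledge(2)[OF assms]]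
  show "code (knowledge \<pi> i) \<in> N" "d (code (knowledge \<pi> i)) = knowledge \<pi> i" .
qed

lemma knowledge_word:
  assumes "\<pi> \<in> Plays G"
  shows "knowledge_word \<pi> \<in> Plays H" "tracks \<pi> (knowledge_word \<pi>)"
proof -
  have "snd (\<pi> i) \<in> alphabet G" for i using assms transitions_subset by (auto simp: Plays_def)
  moreover have "fst (\<pi> 0) = init G" using assms by (simp add: Plays_def)
  \<comment> \<open>The observation of the next state of \<pi> witnesses each transition of
    \<open>H\<close>.\<close>
  ultimately show "knowledge_word \<pi> \<in> Plays H"
    using code_knowledge[OF assms] obs_class_obs(1)[OF Plays_states[OF assms]]
    by (auto simp: Plays_def knowledge_word_def simp del: knowledge.simps(2))
      (metis knowledge.simps(2))
  show "tracks \<pi> (knowledge_word \<pi>)"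
    using knowledge(1)[OF assms] code_knowledge(2)[OF assms]
    by (simp add: tracks_def knowledge_word_def)
qed

text \<open>Although \<open>knowledge\<close> is defined along a whole play, it uses only letters
  and observations, apart from the initial state, which all plays share. Hence
  \<open>knowledge_word\<close> respects indistinguishability.\<close>

lemma knowledge_cong:
  assumes "\<pi> \<in> Plays G" "\<pi>' \<in> Plays G" "i \<le> n"
    and "\<forall>i<n. snd (\<pi> i) = snd (\<pi>' i)" "\<forall>i\<le>n. obs (fst (\<pi> i)) = obs (fst (\<pi>' i))"
  shows "knowledge \<pi> i = knowledge \<pi>' i"
  using assms(3)
proof (induction i)
  case 0
  then show ?case using assms(1,2) by (simp add: Plays_def)
next
  case (Suc i)
  then show ?case using assms(4,5) by simp
qed

text \<open>A state of one knowledge set need not have a successor in the next, so a forward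
  construction can get stuck. Backwards it cannot: the next set is contained in the
  \<open>Post\<close> of the current one. The decoded sets thus serve as the layers of
  \<open>koenig\<close>, and layer zero is the singleton of the initial state.\<close>

lemma tracking_play:
  assumes "\<kappa> \<in> Plays H"
  shows "\<exists>\<pi>\<in>Plays G. tracks \<pi> \<kappa>"
proof -
  note N = Plays_H_states[OF assms]
  have pred: "\<exists>x\<in>d (fst (\<kappa> i)). (x, snd (\<kappa> i), y) \<in> transitions G" if "y \<in> d (fst (\<kappa> (Suc i)))" for i y
  proof -
    have "(fst (\<kappa> i), snd (\<kappa> i), fst (\<kappa> (Suc i))) \<in> transitions H" using assms by (simp add: Plays_def)
    then show ?thesis using that by (auto simp: Post_def)
  qed
  obtain p where p: "\<And>i. p i \<in> d (fst (\<kappa> i))" "\<And>i. (p i, snd (\<kappa> i), p (Suc i)) \<in> transitions G"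
    using koenig[of "\<lambda>i. d (fst (\<kappa> i))" "\<lambda>i x y. (x, snd (\<kappa> i), y) \<in> transitions G"]
      d_nonempty[OF N] finite_subset[OF d_subset[OF N] finite_states] pred by metis
  have "p 0 = init G" using p(1)[of 0] assms init_code by (simp add: Plays_def)
  with p show ?thesis
    by (intro bexI[of _ "\<lambda>i. (p i, snd (\<kappa> i))"]) (auto simp: Plays_def tracks_def)
qed

lemma has_sure_winning_strategy_H_iff:
  "has_sure_winning_strategy G \<phi> \<longleftrightarrow>
    has_sure_winning_strategy H {w. relabel_word (observation_of (observations G) label) w \<in> \<phi>}"
proof
  assume "has_sure_winning_strategy G \<phi>"
  \<comment> \<open>The choice is made separately for each infinite play, so plays with a common
    prefix may have images with different states there. The images are still indistinguishable,
    which is all that an observation-based strategy requires.\<close>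
  define T where "T \<kappa> = (SOME \<pi>. \<pi> \<in> Plays G \<and> tracks \<pi> \<kappa>)" for \<kappa>
  have T: "T \<kappa> \<in> Plays G" "tracks (T \<kappa>) \<kappa>" if "\<kappa> \<in> Plays H" for \<kappa>
    using someI_ex[of "\<lambda>\<pi>. \<pi> \<in> Plays G \<and> tracks \<pi> \<kappa>"] tracking_play[OF that] by (auto simp: T_def)
  show "has_sure_winning_strategy H {w. relabel_word (observation_of (observations G) label) w \<in> \<phi>}"
  proof (rule has_sure_winning_strategy_pullback[where T = T])
    fix \<kappa> \<kappa>' n assume \<kappa>: "\<kappa> \<in> Plays H" "\<kappa>' \<in> Plays H"
      and "obs_prefix H (prefix_of \<kappa> n) = obs_prefix H (prefix_of \<kappa>' n)"
    then have eq: "\<forall>i<n. snd (\<kappa> i) = snd (\<kappa>' i)" "\<forall>i\<le>n. fst (\<kappa> i) = fst (\<kappa>' i)"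
      unfolding obs_prefix_eq_iff using observation_of_H Plays_H_states by simp_all
    have "obs (fst (T \<kappa> i)) = observation_of (observations G) label (fst (\<kappa> i))" if "\<kappa> \<in> Plays H" for \<kappa> i
      using label_obs[OF Plays_H_states[OF that], of "fst (T \<kappa> i)" i] T(2)[OF that] by (simp add: tracks_def)
    with eq \<kappa> show "obs_prefix G (prefix_of (T \<kappa>) n) = obs_prefix G (prefix_of (T \<kappa>') n)"
      unfolding obs_prefix_eq_iff using T(2) by (simp add: tracks_def)
  next
    fix \<kappa> assume "\<kappa> \<in> Plays H" "obs_word G (T \<kappa>) \<in> \<phi>"
    then show "obs_word H \<kappa> \<in> {w. relabel_word (observation_of (observations G) label) w \<in> \<phi>}"
      using tracks_obs_word[OF _ T(2)] by simp
  qed (use T \<open>has_sure_winning_strategy G \<phi>\<close> in \<open>auto simp: tracks_def\<close>)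
next
  assume "has_sure_winning_strategy H {w. relabel_word (observation_of (observations G) label) w \<in> \<phi>}"
  then show "has_sure_winning_strategy G \<phi>"
  proof (rule has_sure_winning_strategy_pullback[where T = knowledge_word, rotated -1])
    fix \<pi> \<pi>' n assume \<pi>: "\<pi> \<in> Plays G" "\<pi>' \<in> Plays G"
      and "obs_prefix G (prefix_of \<pi> n) = obs_prefix G (prefix_of \<pi>' n)"
    then have eq: "\<forall>i<n. snd (\<pi> i) = snd (\<pi>' i)" "\<forall>i\<le>n. obs (fst (\<pi> i)) = obs (fst (\<pi>' i))"
      unfolding obs_prefix_eq_iff by simp_all
    then show "obs_prefix H (prefix_of (knowledge_word \<pi>) n) = obs_prefix H (prefix_of (knowledge_word \<pi>') n)"
      unfolding obs_prefix_eq_iff using knowledge_cong[OF \<pi> _ eq] by (simp add: knowledge_word_def)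
  next
    fix \<pi> assume "\<pi> \<in> Plays G"
      "obs_word H (knowledge_word \<pi>) \<in> {w. relabel_word (observation_of (observations G) label) w \<in> \<phi>}"
    then show "obs_word G \<pi> \<in> \<phi>" using tracks_obs_word[OF knowledge_word] by simp
  qed (simp_all add: knowledge_word(1), simp add: knowledge_word_def)
qed


end

theorem theorem3p9:
  fixes G :: "('l, 'a, 'o) game" and \<phi> :: "('o, 'a) word set" and f :: "'o mu"
  assumes "game_structure G"
    and "omega_regular (observations G \<times> alphabet G) \<phi>"
    and "characteristic_formula (observations G) (alphabet G) \<phi> f"
  shows "has_sure_winning_strategy G \<phi> \<longleftrightarrow>
    antichain_le {{init G}} (antichain_value G f)"
proof -
  let ?C = "{s. s \<noteq> {} \<and> (\<exists>ob\<in>observations G. s \<subseteq> obs_class G ob)}"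
  have "\<Union> (obs_class G ` observations G) = states G"
    using assms(1) by (simp add: game_structure_def obs_partition_def partition_on_def)
  then have "?C \<subseteq> Pow (states G)" by blast
  then have "finite ?C" using assms(1) by (auto simp: game_structure_def intro: finite_subset)
  then obtain d where d: "bij_betw d {0..<card ?C} ?C" using ex_bij_betw_nat_finite by blast
  interpret subset_construction G "{0..<card ?C}" d
    using assms(1) d by unfold_locales
  have f: "atoms f \<subseteq> observations G"
    using assms(3) by (simp add: characteristic_formula_def)
  \<comment> \<open>Winning states are defined by moving the initial state; at the code of the
    initial singleton this gives back \<open>H\<close>.\<close>
  have init: "H\<lparr>init := code {init G}\<rparr> = H" by (simp add: H_def)
  have "subset_value H label f =
    sure_winning_states H {w. relabel_word (observation_of (observations G) label) w \<in> \<phi>}"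
    using assms(3) game_structure_H perfect_information_H label_partition
    unfolding characteristic_formula_def by simp
  then have "has_sure_winning_strategy G \<phi> \<longleftrightarrow> code {init G} \<in> subset_value H label f"
    using init_code(1)
    by (simp add: has_sure_winning_strategy_H_iff sure_winning_states_def init)
  also have "subset_value H label f = below (antichain_value G f)"
    unfolding antichain_value_def subset_value_def
    using below_antichain_sem[OF f, of "\<lambda>_. {}"] by (simp add: below_empty antichains_def)
  \<comment> \<open>The code decodes to the initial singleton, so both sides say that some member of
    the value contains \<open>init G\<close>.\<close>
  also have "code {init G} \<in> below (antichain_value G f) \<longleftrightarrow>
    antichain_le {{init G}} (antichain_value G f)"
    using init_code by (simp add: below_def antichain_le_def)
  finally show ?thesis .
qed

end
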